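(* Let $d\in\mathbb{Q}$, $\ell\in\mathbb{N}$, and $z\in\mathbb{C}$. Write $z=(z_0+j)/\ell$ with $j\in\mathbb{Z}$, $z_0=x_0+iy_0$, $x_0,y_0\in\mathbb{R}$, $-1/2<x_0\le 1/2$. Then, as $t\to0^+$, for every $N\in\mathbb{N}_0$: (i) If $\operatorname{Im}(z)>0$, or ($\operatorname{Im}(z)<0$ and $|x_0|>|y_0|$), or $z\in\mathbb{R}\setminus\frac1\ell\mathbb{Z}$, then $$F_{d,\ell}(z;it)=\sum_{a=0}^N\mathcal{D}_z^{2a}\left(\frac{\zeta^d}{1-\zeta^\ell}\right)\frac{(-2\pi t)^a}{a!}+O\left(t^{N+1}\right).$$ (ii) If $\operatorname{Im}(z)<0$ and $|x_0|\le|y_0|$, then $$F_{d,\ell}(z;it)=\left(2\ell^2t\right)^{-\frac12}e^{\frac{2\pi ijd}{\ell}-\frac{\pi z_0^2}{2\ell^2t}}\sum_{\substack{n\in\mathbb{Z}\\|n+x_0|\le|y_0|}}e^{-\frac{\pi n^2}{2\ell^2t}-\frac{\pi z_0n}{\ell^2t}-\frac{2\pi ind}{\ell}}+\sum_{a=0}^N\mathcal{D}_z^{2a}\left(\frac{\zeta^d}{1-\zeta^\ell}\right)\frac{(-2\pi t)^a}{a!}+O\left(t^{N+1}\right).$$ (iii) If $z\in\frac1\ell\mathbb{Z}$, then $$F_{d,\ell}(z;it)=\frac12\left(2\ell^2t\right)^{-\frac12}\zeta^d-\zeta^d\sum_{a=0}^N\frac{B_{2a+1}\left(\frac d\ell\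right)}{2a+1}\frac{\left(-2\pi\ell^2t\right)^a}{a!}+O\left(t^{N+1}\right).$$
   Context: For $z\in\mathbb{C}$ and $\tau$ in the upper half-plane, $\zeta^x:=e^{2\pi i xz}$ and $q^x:=e^{2\pi i x\tau}$ for $x\in\mathbb{Q}$. The Jacobi partial theta function is $F_{d,\ell}(z;\tau):=\sum_{n\ge0}\zeta^{\ell n+d}q^{(\ell n+d)^2}$. $\mathcal{D}_z:=\frac{1}{2\pi i}\frac{\partial}{\partial z}$. $B_n(x)$ denotes the $n$-th Bernoulli polynomial. Powers of positive reals such as $(2\ell^2t)^{-1/2}$ are positive. *)

theory Defs
  imports
    "HOL-Complex_Analysis.Complex_Analysis"
    "HOL-Library.Landau_Symbols"
begin

text \<open>
  The power \<open>exp (2 \<pi> i x w)\<close>: it is \<open>\<zeta>\<close> to the power \<open>x\<close> for \<open>w = z\<close>,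
  and \<open>q\<close> to the power \<open>x\<close> for \<open>w = \<tau>\<close>.
\<close>
definition epow :: "complex \<Rightarrow> rat \<Rightarrow> complex" where
  "epow w x = exp (2 * of_real pi * \<i> * of_rat x * w)"

definition jacobi_partial_theta :: "rat \<Rightarrow> nat \<Rightarrow> complex \<Rightarrow> complex \<Rightarrow> complex" where
  "jacobi_partial_theta d l z \<tau> =
     (\<Sum>n. epow z (of_nat l * of_nat n + d) * epow \<tau> ((of_nat l * of_nat n + d)\<^sup>2))"

definition D_z :: "(complex \<Rightarrow> complex) \<Rightarrow> complex \<Rightarrow> complex" where
  "D_z f = (\<lambda>z. 1 / (2 * of_real pi * \<i>) * deriv f z)"

text \<open>
  The value at \<open>x\<close> of the \<open>n\<close>-th Bernoulli polynomial, by the exponential generating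
  function \<open>X exp (x X) / (exp X - 1)\<close>.
\<close>
definition bernoulli_poly :: "nat \<Rightarrow> real \<Rightarrow> real" where
  "bernoulli_poly n x = fact n * fps_nth (fps_X * fps_exp x / (fps_exp 1 - 1)) n"

lemma bernoulli_poly_egf:
  "Abs_fps (\<lambda>n. bernoulli_poly n x / fact n) * (fps_exp 1 - 1) = fps_X * fps_exp x"
proof -
  have sd: "subdegree (fps_exp 1 - 1 :: real fps) = 1"
    by (rule subdegreeI) auto
  have "fps_exp 1 - 1 \<noteq> (0 :: real fps)"
    using sd by auto
  moreover have "subdegree (fps_X * fps_exp x :: real fps) = 1"
    by (rule subdegreeI) auto
  ultimately have "(fps_exp 1 - 1 :: real fps) dvd fps_X * fps_exp x"
    using sd by (subst fps_dvd_iff) auto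
  moreover have "Abs_fps (\<lambda>n. bernoulli_poly n x / fact n) = fps_X * fps_exp x / (fps_exp 1 - 1)"
    by (rule fps_ext) (simp add: bernoulli_poly_def)
  ultimately show ?thesis
    by simp
qed

end

theory Submission
  imports Defs "HOL-Probability.Distributions" "HOL-Real_Asymp.Real_Asymp"
begin

text \<open>
  With \<open>T = l\<^sup>2 t\<close>, \<open>\<delta> = d / l\<close> and \<open>\<omega> = \<zeta>\<^sup>l\<close>, the partial theta function is \<open>\<zeta>\<^sup>d\<close> times the
  twisted sum of \<open>\<omega>\<^sup>n f (n + \<delta>)\<close> over \<open>n \<ge> 0\<close>, where \<open>f x = exp (- 2 \<pi> T x\<^sup>2)\<close>.

  For \<open>|\<omega>| \<le> 1\<close> this is an Euler--Maclaurin summation: if \<open>H\<close> is the primitive of \<open>f\<close> that vanishes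
  at infinity and \<open>b\<close> is the power series with \<open>b (1 - \<omega> e\<^sup>X) = X e\<^bsup>\<delta>X\<^esup>\<close>, then formally
  \<open>P = b (d/dx) H\<close> satisfies \<open>P n - \<omega> P (n + 1) = f (n + \<delta>)\<close>, so the sum telescopes to \<open>P 0\<close>.
  Truncating \<open>b\<close> costs a Taylor remainder, which is small because the high derivatives of \<open>f\<close> carry
  powers of \<open>\<surd>T\<close>. The coefficients of \<open>b\<close> are Bernoulli polynomials for \<open>\<omega> = 1\<close> and derivatives of
  \<open>\<zeta>\<^sup>d / (1 - \<zeta>\<^sup>l)\<close> otherwise.

  For \<open>|\<omega>| > 1\<close> the sum over all integers is transformed by Poisson summation, where every dual term
  with \<open>|n + x\<^sub>0| > |y\<^sub>0|\<close> is exponentially small, and the sum over the negative integers is of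
  the first kind with \<open>\<omega>\<close> replaced by \<open>1 / \<omega>\<close>.
\<close>

section \<open>The primitive and the derivatives of the Gaussian\<close>


text \<open>The unit circle shapes the first half: there the weights \<open>\<omega> ^ n\<close> do
  not decay, and at \<open>\<omega> = 1\<close> the sum blows up like \<open>1 / sqrt T\<close>.
  Solving a difference equation for \<open>P\<close> treats all cases together, since it asks only
  that \<open>P\<close> tend to 0; the blow-up sits in the constant coefficient of \<open>b\<close>,
  which is nonzero exactly for \<open>\<omega> = 1\<close>. The operator series runs to order
  \<open>2 * (N + 2)\<close>: its error carries \<open>T ^ (N + 2)\<close>, one factor
  \<open>T\<close> pays for a majorant in \<open>n\<close> that is independent of \<open>T\<close>,
  and the surplus term \<open>a = N + 1\<close> is absorbed into the error. On the dual side, up to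
  the factor \<open>1 / sqrt (2 * T)\<close>, the term of index \<open>n\<close> has modulus
  \<open>exp (- (pi * ((n + x0)^2 - y0^2) / (2 * T)))\<close>. Equality of \<open>|n + x0|\<close>
  and \<open>|y0|\<close> therefore gives a term that does not become small, so it belongs to the
  main part. The reflection of the negative integers turns the geometric expansion into its
  negative, because only derivatives of even order occur. Subtracting that half from the full sum
  thus restores the very expansion valid in the upper half-plane.\<close>

definition gauss_primitive :: "complex \<Rightarrow> complex" where
  "gauss_primitive w = contour_integral (linepath 0 w) (\<lambda>u. exp (- (u ^ 2)))"

text \<open>\<open>gauss_primitive\<close> is \<open>sqrt pi / 2\<close> times the error function.
  The plane is convex, so the integrand has a global primitive, and the path integral differs from
  it by a constant only.\<close>

lemma gauss_primitive_has_field_derivative: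
  "(gauss_primitive has_field_derivative exp (- (w ^ 2))) (at w)"
proof -
  have "(\<lambda>u::complex. exp (- (u ^ 2))) holomorphic_on UNIV"
    by (intro holomorphic_intros)
  then obtain g where g: "\<And>x. (g has_field_derivative exp (- (x ^ 2))) (at (x::complex))"
    using holomorphic_convex_primitive'[of UNIV "\<lambda>u. exp (- (u ^ 2))"] by auto
  have "gauss_primitive w = g w - g 0" for w
    unfolding gauss_primitive_def
    using contour_integral_primitive[of UNIV g "\<lambda>u. exp (- (u ^ 2))" "linepath 0 w"] g
    by (auto intro!: contour_integral_unique)
  then have "gauss_primitive = (\<lambda>w. g w - g 0)"
    by auto
  moreover have "((\<lambda>w. g w - g 0) has_field_derivative exp (- (w ^ 2))) (at w)"
    using DERIV_diff[OF g DERIV_const] by simp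
  ultimately show ?thesis
    by simp
qed

lemma gauss_primitive_0 [simp]: "gauss_primitive 0 = 0"
  by (simp add: gauss_primitive_def)

lemma gauss_primitive_minus: "gauss_primitive (- w) = - gauss_primitive w"
proof -
  have "((\<lambda>w. gauss_primitive w + gauss_primitive (- w)) has_field_derivative 0) (at u)" for u
    using DERIV_add[OF gauss_primitive_has_field_derivative[of u]
        DERIV_chain2[OF gauss_primitive_has_field_derivative DERIV_minus[OF DERIV_ident]]] by simp
  then obtain c where "\<And>w. gauss_primitive w + gauss_primitive (- w) = c"
    using has_field_derivative_zero_constant[of UNIV "\<lambda>w. gauss_primitive w + gauss_primitive (- w)"]
    by auto
  from this[of w] this[of 0] show ?thesis
    by (simp add: add_eq_0_iff)
qed

text \<open>Write \<open>w = x + u + i v\<close>. The identity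
  \<open>(u + x)^2 = x^2 / 2 - u^2 + (2 u + x)^2 / 2\<close> gives up half of the Gaussian decay in
  order to remove the cross term. The bound is uniform on discs, as the mean value estimate and
  Cauchy's inequality below require.\<close>

lemma norm_exp_minus_square_le:
  fixes x :: real and w :: complex
  assumes "norm (w - of_real x) \<le> r"
  shows "norm (exp (- (w ^ 2))) \<le> exp (2 * r\<^sup>2) * exp (- (x\<^sup>2 / 2))"
proof -
  define u v where "u = Re w - x" and "v = Im w"
  have "u\<^sup>2 + v\<^sup>2 \<le> r\<^sup>2"
    using power_mono[OF assms, of 2] by (simp add: cmod_power2 u_def v_def)
  moreover have "- Re (w ^ 2) = v\<^sup>2 - (u + x)\<^sup>2"
    by (simp add: u_def v_def power2_eq_square)
  moreover have "(u + x)\<^sup>2 = x\<^sup>2 / 2 - u\<^sup>2 + (2 * u + x)\<^sup>2 / 2"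
    by (simp add: power2_eq_square field_simps)
  moreover have "(2 * u + x)\<^sup>2 \<ge> 0" "u\<^sup>2 \<ge> 0" "v\<^sup>2 \<ge> 0"
    by auto
  ultimately have "- Re (w ^ 2) \<le> 2 * r\<^sup>2 + - (x\<^sup>2 / 2)"
    by linarith
  then show ?thesis
    by (simp add: norm_exp_eq_Re flip: exp_add)
qed

text \<open>The limit is the Gaussian integral over the half-line; on each \<open>[0, y]\<close> the
  fundamental theorem of calculus turns the integral into \<open>gauss_primitive\<close>.\<close>

lemma gauss_primitive_at_top:
  "((\<lambda>x. gauss_primitive (of_real x)) \<longlongrightarrow> of_real (sqrt pi / 2)) at_top"
proof -
  define f :: "real \<Rightarrow> complex" where "f = (\<lambda>x. of_real (indicator {0..} x *\<^sub>R exp (- x\<^sup>2)))"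
  have f: "has_bochner_integral lborel f (of_real (sqrt pi / 2))"
    unfolding f_def by (rule has_bochner_integral_of_real[OF gaussian_moment_0])
  have "((\<lambda>y. \<integral> x. indicator {.. y} x *\<^sub>R f x \<partial>lborel) \<longlongrightarrow> \<integral> x. f x \<partial>lborel) at_top"
    using f by (intro tendsto_integral_at_top) (auto simp: has_bochner_integral_iff)
  then have lim: "((\<lambda>y. \<integral> x. indicator {.. y} x *\<^sub>R f x \<partial>lborel) \<longlongrightarrow> of_real (sqrt pi / 2)) at_top"
    using f unfolding has_bochner_integral_iff by simp
  have "(\<integral> x. indicator {.. y} x *\<^sub>R f x \<partial>lborel) = gauss_primitive (of_real y)" if "y \<ge> 0" for y
  proof -
    have "(\<integral> x. indicator {.. y} x *\<^sub>R f x \<partial>lborel) =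
          (\<integral> x. indicator {0 .. y} x *\<^sub>R exp (- ((of_real x :: complex) ^ 2)) \<partial>lborel)"
      by (intro Bochner_Integration.integral_cong)
         (auto simp: f_def indicator_def simp flip: exp_of_real)
    also have "\<dots> = gauss_primitive (of_real y) - gauss_primitive (of_real 0)"
    proof (rule integral_FTC_atLeastAtMost)
      show "((\<lambda>x. gauss_primitive (of_real x)) has_vector_derivative exp (- ((of_real x) ^ 2)))
              (at x within {0..y})" for x
        using has_field_derivative_at_within[OF gauss_primitive_has_field_derivative]
        by (intro has_vector_derivative_real_field)
    qed (use that in \<open>auto intro!: continuous_intros\<close>)
    finally show ?thesis by simp
  qed
  then have "eventually (\<lambda>y. (\<integral> x. indicator {.. y} x *\<^sub>R f x \<partial>lborel) = gauss_primitive (of_real y)) at_top"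
    by (rule eventually_mono[OF eventually_ge_at_top[of 0]])
  with lim show ?thesis
    by (simp cong: tendsto_cong)
qed

lemma exp_minus_half_square_tendsto_0: "((\<lambda>x::real. exp (- (x\<^sup>2 / 2))) \<longlongrightarrow> 0) at_top"
  by real_asymp

text \<open>Moving the argument by \<open>c\<close> costs at most \<open>norm c\<close> times the
  supremum of the derivative on the disc of radius \<open>norm c\<close> around \<open>x\<close>,
  which tends to 0. Poisson summation needs the primitive along such shifted lines.\<close>

lemma gauss_primitive_shifted_at_top:
  "((\<lambda>x. gauss_primitive (of_real x + c)) \<longlongrightarrow> of_real (sqrt pi / 2)) at_top"
proof -
  define B where "B = exp (2 * (norm c)\<^sup>2) * norm c"
  have "norm (gauss_primitive (of_real x + c) - gauss_primitive (of_real x))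
          \<le> B * exp (- (x\<^sup>2 / 2))" for x :: real
  proof -
    have "norm (gauss_primitive (of_real x + c) - gauss_primitive (of_real x))
            \<le> exp (2 * (norm c)\<^sup>2) * exp (- (x\<^sup>2 / 2)) * norm (of_real x + c - of_real x)"
    proof (rule field_differentiable_bound)
      show "convex (cball (of_real x :: complex) (norm c))" by simp
      show "(gauss_primitive has_field_derivative exp (- (w ^ 2))) (at w within cball (of_real x) (norm c))" for w
        by (rule has_field_derivative_at_within[OF gauss_primitive_has_field_derivative])
      show "norm (exp (- (w ^ 2))) \<le> exp (2 * (norm c)\<^sup>2) * exp (- (x\<^sup>2 / 2))"
        if "w \<in> cball (of_real x) (norm c)" for w :: complex
        using that by (intro norm_exp_minus_square_le) (auto simp: dist_norm norm_minus_commute)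
    qed (simp_all add: dist_norm)
    then show ?thesis by (simp add: B_def mult.commute mult.left_commute)
  qed
  moreover have "((\<lambda>x. B * exp (- (x\<^sup>2 / 2))) \<longlongrightarrow> 0) at_top"
    using tendsto_mult_right_zero[OF exp_minus_half_square_tendsto_0] by simp
  ultimately have "((\<lambda>x. gauss_primitive (of_real x + c) - gauss_primitive (of_real x)) \<longlongrightarrow> 0) at_top"
    by (rule Lim_null_comparison[OF always_eventually[OF allI]])
  from tendsto_add[OF this gauss_primitive_at_top] show ?thesis by simp
qed

text \<open>Cauchy's inequality on the circle of radius 1 transfers the decay of the Gaussian to its
  derivatives. The decay is then weakened to an inverse square, enough to sum over the
  integers.\<close>

lemma higher_deriv_gaussian_decay:
  obtains C where "C > 0" and "\<And>x::real. norm ((deriv ^^ k) (\<lambda>w::complex. exp (- (w ^ 2))) (of_real x)) \<le> C / (1 + x\<^sup>2)"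
proof
  define C :: real where "C = 2 * (fact k * exp 2)"
  show "C > 0" by (simp add: C_def)
  fix x :: real
  have "norm ((deriv ^^ k) (\<lambda>w::complex. exp (- (w ^ 2))) (of_real x))
          \<le> fact k * (exp (2 * 1\<^sup>2) * exp (- (x\<^sup>2 / 2))) / 1 ^ k"
  proof (rule Cauchy_inequality)
    show "norm (exp (- (w ^ 2))) \<le> exp (2 * 1\<^sup>2) * exp (- (x\<^sup>2 / 2))"
      if "norm (of_real x - w) = 1" for w :: complex
      using that by (intro norm_exp_minus_square_le) (auto simp: norm_minus_commute)
  qed (auto intro!: holomorphic_intros continuous_intros)
  moreover have "exp (- (x\<^sup>2 / 2)) \<le> 2 / (1 + x\<^sup>2)"
  proof -
    have "(1 + x\<^sup>2) / 2 \<le> 1 + x\<^sup>2 / 2" by simp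
    also have "\<dots> \<le> exp (x\<^sup>2 / 2)" by (rule exp_ge_add_one_self)
    finally show ?thesis
      by (simp add: exp_minus field_simps add_pos_nonneg)
  qed
  then have "fact k * exp 2 * exp (- (x\<^sup>2 / 2)) \<le> fact k * exp 2 * (2 / (1 + x\<^sup>2))"
    by (intro mult_left_mono) auto
  ultimately show "norm ((deriv ^^ k) (\<lambda>w::complex. exp (- (w ^ 2))) (of_real x)) \<le> C / (1 + x\<^sup>2)"
    by (simp add: C_def mult_ac)
qed

text \<open>The values are read off from the power series of \<open>exp (- (w ^ 2))\<close>,
  obtained by composing formal power series.\<close>

lemma higher_deriv_gaussian_0:
  "(deriv ^^ k) (\<lambda>w::complex. exp (- (w ^ 2))) 0 =
     (if even k then fact k * (- 1) ^ (k div 2) / fact (k div 2) else 0)"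
proof -
  have "(exp \<circ> (\<lambda>w::complex. - (w ^ 2))) has_fps_expansion fps_compose (fps_exp 1) (- (fps_X ^ 2))"
    by (intro fps_expansion_intros) auto
  then have A: "fps_nth (fps_compose (fps_exp 1) (- (fps_X ^ 2))) k =
      (deriv ^^ k) (\<lambda>w::complex. exp (- (w ^ 2))) 0 / fact k"
    by (subst fps_nth_fps_expansion) (simp_all add: o_def)
  have neg1: "(- 1 :: complex fps) ^ i = fps_const ((- 1) ^ i)" for i
    by (metis fps_const_1_eq_1 fps_const_neg fps_const_power)
  have "fps_nth (fps_compose (fps_exp 1) (- (fps_X ^ 2))) k =
      (\<Sum>i=0..k. (- 1) ^ i / fact i * (if k = 2 * i then 1 else 0 :: complex))"
    unfolding fps_compose_nth
    by (intro sum.cong refl)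
       (auto simp: power_mult[symmetric] fps_X_power_nth power_minus[of "fps_X ^ 2"] neg1)
  moreover have "\<dots> = (if even k then (- 1) ^ (k div 2) / fact (k div 2) else 0)"
  proof (cases "even k")
    case True
    then obtain a where "k = 2 * a" by auto
    then show ?thesis by (simp add: sum.delta if_distrib cong: if_cong)
  next
    case False
    then show ?thesis by (auto intro!: sum.neutral)
  qed
  ultimately have "(deriv ^^ k) (\<lambda>w::complex. exp (- (w ^ 2))) 0 / fact k =
      (if even k then (- 1) ^ (k div 2) / fact (k div 2) else 0)"
    using A by simp
  then show ?thesis by (simp add: divide_eq_eq split: if_splits)
qed

section \<open>Twisted Euler--Maclaurin summation\<close>

text \<open>The weighted differences \<open>\<omega> ^ n * (P n - \<omega> * P (Suc n))\<close>
  telescope to \<open>P 0\<close>. \<open>P\<close> solves the difference equation only up to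
  \<open>\<beta>\<close>, and the weights, of modulus at most 1, do not enlarge these
  errors.\<close>

lemma twisted_telescoping_sums:
  fixes \<omega> :: complex and f P :: "nat \<Rightarrow> complex" and \<beta> :: "nat \<Rightarrow> real"
  assumes "norm \<omega> \<le> 1"
    and bound: "\<And>n. norm (f n - (P n - \<omega> * P (Suc n))) \<le> \<beta> n"
    and "\<beta> sums Z" and P: "P \<longlonglongrightarrow> 0"
  shows "summable (\<lambda>n. \<omega> ^ n * f n)" and "norm ((\<Sum>n. \<omega> ^ n * f n) - P 0) \<le> Z"
proof -
  define e where "e = (\<lambda>n. \<omega> ^ n * (f n - (P n - \<omega> * P (Suc n))))"
  have pow: "norm (\<omega> ^ n) \<le> 1" for n
    using assms(1) by (simp add: norm_power power_le_one)
  have e: "norm (e n) \<le> \<beta> n" for n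
    using mult_mono[OF pow[of n] bound[of n]] by (simp add: e_def norm_mult)
  have "summable \<beta>" and Z: "suminf \<beta> = Z"
    using assms(3) by (auto simp: sums_iff)
  then have "summable (\<lambda>n. norm (e n))"
    using e by (intro summable_comparison_test[of "\<lambda>n. norm (e n)" \<beta>]) auto
  then have se: "summable e" and ne: "norm (suminf e) \<le> Z"
    using summable_norm_cancel summable_norm[of e] suminf_le[OF e] \<open>summable \<beta>\<close> Z by fastforce+
  have "(\<lambda>n. \<omega> ^ n * P n) \<longlonglongrightarrow> 0"
  proof (rule Lim_null_comparison)
    show "eventually (\<lambda>n. norm (\<omega> ^ n * P n) \<le> norm (P n)) sequentially"
      using mult_right_mono[OF pow norm_ge_zero[of "P _"]]
      by (intro always_eventually allI) (simp add: norm_mult)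
  qed (use P in \<open>simp add: tendsto_norm_zero\<close>)
  from sums_add[OF summable_sums[OF se] telescope_sums'[OF this]]
  have "(\<lambda>n. \<omega> ^ n * f n) sums (suminf e + P 0)"
    by (simp add: e_def algebra_simps)
  with ne show "summable (\<lambda>n. \<omega> ^ n * f n)" and "norm ((\<Sum>n. \<omega> ^ n * f n) - P 0) \<le> Z"
    by (auto simp: sums_iff)
qed

text \<open>Read \<open>c k\<close> as the \<open>k\<close>-th derivative at a point, so that
  \<open>X\<close> acts as differentiation and \<open>exp X\<close> as translation by 1. The
  identity is \<open>b (1 - \<omega> exp X) = X exp (\<delta> X)\<close> applied to \<open>c\<close>
  and cut off at total order \<open>m\<close>.\<close>

lemma taylor_operator_identity:
  fixes b :: "complex fps" and c :: "nat \<Rightarrow> complex"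
  assumes b: "b * (1 - fps_const \<omega> * fps_exp 1) = fps_X * fps_exp \<delta>"
  shows "(\<Sum>k\<le>m. fps_nth b k * (c k - \<omega> * (\<Sum>i\<le>m - k. c (k + i) / fact i)))
           = (\<Sum>i<m. \<delta> ^ i / fact i * c (Suc i))"
proof -
  define S where "S k = (\<Sum>i\<le>m - k. c (k + i) / fact i)" for k
  have "(\<Sum>k\<le>m. fps_nth b k * S k) =
        (\<Sum>k\<le>m. \<Sum>i\<le>m - k. fps_nth b k * (c (k + i) / fact i))"
    by (simp add: S_def sum_distrib_left)
  also have "\<dots> = (\<Sum>(k,i)\<in>Sigma {..m} (\<lambda>k. {..m - k}). fps_nth b k * (c (k + i) / fact i))"
    by (rule sum.Sigma) auto
  also have "Sigma {..m} (\<lambda>k. {..m - k}) = {(k,i). k + i \<le> m}"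
    by auto
  \<comment> \<open>Grouping by \<open>j = k + i\<close> turns the coefficient of \<open>c j\<close>
    into a Cauchy product; the triangle contains every pair with \<open>j \<le> m\<close>, so the
    cut-off loses nothing.\<close>
  also have "(\<Sum>(k,i)\<in>{(k,i). k + i \<le> m}. fps_nth b k * (c (k + i) / fact i)) =
      (\<Sum>j\<le>m. \<Sum>k\<le>j. fps_nth b k * (c (k + (j - k)) / fact (j - k)))"
    by (rule sum.triangle_reindex_eq)
  also have "\<dots> = (\<Sum>j\<le>m. fps_nth (b * fps_exp 1) j * c j)"
    by (auto simp: fps_mult_nth sum_distrib_right atLeast0AtMost intro!: sum.cong)
  finally have S: "(\<Sum>k\<le>m. fps_nth b k * S k) = (\<Sum>j\<le>m. fps_nth (b * fps_exp 1) j * c j)" .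
  have "(\<Sum>k\<le>m. fps_nth b k * (c k - \<omega> * S k)) =
      (\<Sum>j\<le>m. fps_nth b j * c j) - \<omega> * (\<Sum>k\<le>m. fps_nth b k * S k)"
    by (simp add: right_diff_distrib sum_subtractf sum_distrib_left mult.left_commute)
  also have "\<dots> = (\<Sum>j\<le>m. fps_nth b j * c j) - \<omega> * (\<Sum>j\<le>m. fps_nth (b * fps_exp 1) j * c j)"
    by (simp only: S)
  also have "\<dots> = (\<Sum>j\<le>m. fps_nth (b * (1 - fps_const \<omega> * fps_exp 1)) j * c j)"
  proof -
    have "b * (1 - fps_const \<omega> * fps_exp 1) = b - fps_const \<omega> * (b * fps_exp 1)"
      by (simp add: algebra_simps)
    then show ?thesis
      by (simp only: fps_sub_nth fps_mult_left_const_nth left_diff_distrib sum_subtractf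
          sum_distrib_left mult.assoc)
  qed
  also have "\<dots> = (\<Sum>j\<in>{0..m}. fps_nth (fps_X * fps_exp \<delta>) j * c j)"
    by (simp add: b atLeast0AtMost)
  also have "\<dots> = (\<Sum>i<m. \<delta> ^ i / fact i * c (Suc i))"
    by (subst sum.atLeast0_atMost_Suc_shift[symmetric] | simp add: atMost_atLeast0[symmetric] sum.atMost_shift)+
  finally show ?thesis by (simp add: S_def)
qed

text \<open>Expanding around \<open>x\<close>, all Taylor polynomials cancel by
  \<open>taylor_operator_identity\<close>. Only remainders survive: those of
  \<open>h k (x + 1)\<close>, weighted by the coefficients of \<open>b\<close>, and that of
  \<open>h 1 (x + \<delta>)\<close>.\<close>

lemma twisted_difference_bound:
  fixes b :: "complex fps" and h :: "nat \<Rightarrow> complex \<Rightarrow> complex"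
  assumes b: "b * (1 - fps_const \<omega> * fps_exp 1) = fps_X * fps_exp \<delta>"
    and h: "\<And>k x. (h k has_field_derivative h (Suc k) x) (at x)"
    and "norm \<omega> \<le> 1" and "convex S" and x: "x \<in> S" "x + 1 \<in> S" "x + \<delta> \<in> S"
    and B: "\<And>y. y \<in> S \<Longrightarrow> norm (h (Suc m) y) \<le> B" and m: "m > 0"
  shows "norm (h 1 (x + \<delta>) - ((\<Sum>k\<le>m. fps_nth b k * h k x) - \<omega> * (\<Sum>k\<le>m. fps_nth b k * h k (x + 1))))
           \<le> ((\<Sum>k\<le>m. norm (fps_nth b k)) + norm \<delta> ^ m) * B"
proof -
  have B0: "B \<ge> 0"
    using B[OF x(1)] norm_ge_zero order_trans by blast
  \<comment> \<open>The expansion order \<open>m - k\<close> decreases with \<open>k\<close>, so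
    every remainder involves the same derivative \<open>h (Suc m)\<close>.\<close>
  have taylor: "norm (h k y - (\<Sum>i\<le>m - k. h (k + i) x * (y - x) ^ i / fact i))
      \<le> B * norm (y - x) ^ Suc (m - k)" if "k \<le> m" "y \<in> S" for k y
  proof -
    have "norm (h (k + 0) y - (\<Sum>i\<le>m - k. h (k + i) x * (y - x) ^ i / fact i))
      \<le> B * norm (y - x) ^ Suc (m - k) / fact (m - k)"
      using that B x(1) has_field_derivative_at_within[OF h]
      by (intro complex_Taylor[OF \<open>convex S\<close>, of "m - k" "\<lambda>i. h (k + i)"]) auto
    moreover have "B * norm (y - x) ^ Suc (m - k) / fact (m - k) \<le> B * norm (y - x) ^ Suc (m - k) / 1"
      using B0 by (intro divide_left_mono) auto
    ultimately show ?thesis by simp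
  qed
  define r where "r k = h k (x + 1) - (\<Sum>i\<le>m - k. h (k + i) x / fact i)" for k
  define q where "q = h 1 (x + \<delta>) - (\<Sum>i<m. \<delta> ^ i / fact i * h (Suc i) x)"
  have r: "norm (r k) \<le> B" if "k \<le> m" for k
    using taylor[OF that x(2)] by (simp add: r_def)
  have "(\<Sum>i\<le>m - 1. h (1 + i) x * (x + \<delta> - x) ^ i / fact i) = (\<Sum>i<m. \<delta> ^ i / fact i * h (Suc i) x)"
    using m by (intro sum.cong) (auto simp: mult_ac)
  with taylor[of 1 "x + \<delta>"] m x(3) have q: "norm q \<le> B * norm \<delta> ^ m"
    by (simp add: q_def)
  have "h 1 (x + \<delta>) - ((\<Sum>k\<le>m. fps_nth b k * h k x) - \<omega> * (\<Sum>k\<le>m. fps_nth b k * h k (x + 1))) =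
     q + \<omega> * (\<Sum>k\<le>m. fps_nth b k * r k)"
  proof -
    have "(\<Sum>k\<le>m. fps_nth b k * h k x) - \<omega> * (\<Sum>k\<le>m. fps_nth b k * h k (x + 1)) =
       (\<Sum>k\<le>m. fps_nth b k * (h k x - \<omega> * (\<Sum>i\<le>m - k. h (k + i) x / fact i)))
        - \<omega> * (\<Sum>k\<le>m. fps_nth b k * r k)"
      by (simp add: r_def algebra_simps sum_subtractf sum_distrib_left)
    also have "\<dots> = (\<Sum>i<m. \<delta> ^ i / fact i * h (Suc i) x) - \<omega> * (\<Sum>k\<le>m. fps_nth b k * r k)"
      by (subst taylor_operator_identity[OF b, where m = m and c = "\<lambda>k. h k x"]) simp
    finally show ?thesis by (simp add: q_def)
  qed
  also have "norm (q + \<omega> * (\<Sum>k\<le>m. fps_nth b k * r k)) \<le> norm q + norm \<omega> * norm (\<Sum>k\<le>m. fps_nth b k * r k)"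
    using norm_triangle_ineq[of q "\<omega> * (\<Sum>k\<le>m. fps_nth b k * r k)"] by (simp add: norm_mult)
  also have "\<dots> \<le> B * norm \<delta> ^ m + 1 * (\<Sum>k\<le>m. norm (fps_nth b k) * B)"
    using q r \<open>norm \<omega> \<le> 1\<close>
    by (intro add_mono mult_mono sum_norm_le) (auto simp: norm_mult intro!: mult_left_mono)
  finally show ?thesis
    by (simp add: algebra_simps sum_distrib_left)
qed

text \<open>Replacing \<open>y\<close> by the nearby \<open>x\<close> costs the constant
  \<open>2 + 2 c^2\<close>; since \<open>T \<le> 1\<close>, the factor \<open>1 / T\<close> then
  frees the dependence on \<open>x\<close> from \<open>T\<close>. That factor is what the order of
  the expansion has to compensate.\<close>

lemma inverse_one_plus_square_shift:
  fixes T c x y :: real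
  assumes "0 < T" "T \<le> 1" "\<bar>y - x\<bar> \<le> c"
  shows "1 / (1 + 2 * pi * T * y\<^sup>2) \<le> (2 + 2 * c\<^sup>2) / T * (1 / (1 + x\<^sup>2))"
proof -
  have "(x - y)\<^sup>2 \<le> c\<^sup>2"
    using assms(3) by (metis abs_le_square_iff abs_minus_commute abs_of_nonneg abs_ge_zero order_trans)
  \<comment> \<open>This square completes the identity
    \<open>x^2 = 2 (x - y)^2 + 2 y^2 - (x - 2 y)^2\<close>.\<close>
  moreover have "0 \<le> (x - 2 * y)\<^sup>2" by simp
  ultimately have "x\<^sup>2 \<le> 2 * c\<^sup>2 + 2 * y\<^sup>2"
    by (simp add: power2_eq_square algebra_simps)
  moreover have "2 * c\<^sup>2 + 2 * y\<^sup>2 + 1 \<le> (2 + 2 * c\<^sup>2) * (1 + y\<^sup>2)"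
    using zero_le_power2[of c] zero_le_power2[of y] mult_nonneg_nonneg[of "c\<^sup>2" "y\<^sup>2"]
    by (simp add: algebra_simps)
  ultimately have "1 + x\<^sup>2 \<le> (2 + 2 * c\<^sup>2) * (1 + y\<^sup>2)" by linarith
  then have "T * (1 + x\<^sup>2) \<le> T * ((2 + 2 * c\<^sup>2) * (1 + y\<^sup>2))"
    using assms by (intro mult_left_mono) auto
  also have "\<dots> = (2 + 2 * c\<^sup>2) * (T + T * y\<^sup>2)"
    by (simp add: algebra_simps)
  also have "\<dots> \<le> (2 + 2 * c\<^sup>2) * (1 + 2 * pi * T * y\<^sup>2)"
  proof (intro mult_left_mono add_mono)
    have "1 * (T * y\<^sup>2) \<le> (2 * pi) * (T * y\<^sup>2)"
      using assms pi_ge_two by (intro mult_right_mono) auto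
    then show "T * y\<^sup>2 \<le> 2 * pi * T * y\<^sup>2" by (simp add: mult_ac)
  qed (use assms in auto)
  finally show ?thesis
    using assms by (simp add: divide_simps add_pos_nonneg mult_ac)
qed

lemma inverse_one_plus_square_summable: "summable (\<lambda>n. 1 / (1 + (real n)\<^sup>2))"
proof (rule summable_comparison_test')
  show "summable (\<lambda>n. 1 / (real n)\<^sup>2)"
    using inverse_power_summable[of 2, where 'a = real] by (simp add: divide_inverse)
  show "norm (1 / (1 + (real n)\<^sup>2)) \<le> 1 / (real n)\<^sup>2" if "n \<ge> 1" for n
    using that by (auto intro!: divide_left_mono mult_pos_pos add_pos_nonneg)
qed

lemma sum_even_indices:
  fixes f :: "nat \<Rightarrow> complex"
  assumes "\<And>i. odd i \<Longrightarrow> f i = 0"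
  shows "(\<Sum>i<2 * n. f i) = (\<Sum>a<n. f (2 * a))"
  using assms by (induction n) auto

section \<open>The scaled Gaussian and its expansion at 0\<close>

definition scaled_gauss_deriv :: "real \<Rightarrow> nat \<Rightarrow> complex \<Rightarrow> complex" where
  "scaled_gauss_deriv s k w =
     (case k of 0 \<Rightarrow> (gauss_primitive (of_real s * w) - of_real (sqrt pi / 2)) / of_real s
      | Suc i \<Rightarrow> of_real s ^ i * (deriv ^^ i) (\<lambda>w. exp (- (w ^ 2))) (of_real s * w))"

text \<open>Index 0 is the primitive of \<open>exp (- ((s w)^2))\<close> that vanishes at plus
  infinity, so index \<open>Suc i\<close> belongs to the \<open>i\<close>-th derivative of the
  Gaussian and carries \<open>s ^ i\<close>, not \<open>s ^ (i + 1)\<close>.\<close>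

lemma scaled_gauss_deriv_has_field_derivative:
  assumes "s > 0"
  shows "(scaled_gauss_deriv s k has_field_derivative scaled_gauss_deriv s (Suc k) w) (at w)"
proof (cases k)
  case 0
  have "((\<lambda>w. (gauss_primitive (of_real s * w) - of_real (sqrt pi / 2)) / of_real s) has_field_derivative
          (exp (- ((of_real s * w) ^ 2)) * of_real s - 0) / of_real s) (at w)"
    by (intro DERIV_cdivide DERIV_diff DERIV_const DERIV_chain2[OF gauss_primitive_has_field_derivative])
       (auto intro!: derivative_eq_intros)
  then show ?thesis
    using assms 0 by (simp add: scaled_gauss_deriv_def[abs_def])
next
  case (Suc i)
  let ?g = "\<lambda>w::complex. exp (- (w ^ 2))"
  have "((deriv ^^ i) ?g has_field_derivative (deriv ^^ Suc i) ?g u) (at u)" for u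
    by (rule has_field_derivative_higher_deriv[of _ UNIV]) (auto intro!: holomorphic_intros)
  then have "((\<lambda>w. of_real s ^ i * (deriv ^^ i) ?g (of_real s * w)) has_field_derivative
      of_real s ^ i * ((deriv ^^ Suc i) ?g (of_real s * w) * of_real s)) (at w)"
    by (intro DERIV_cmult DERIV_chain2[of "(deriv ^^ i) ?g"]) (auto intro!: derivative_eq_intros)
  then show ?thesis
    using Suc by (simp add: scaled_gauss_deriv_def[abs_def] mult_ac)
qed

lemma scaled_gauss_deriv_1:
  assumes "T > 0"
  shows "scaled_gauss_deriv (sqrt (2 * pi * T)) 1 w = exp (- 2 * of_real pi * of_real T * w ^ 2)"
proof -
  have "(of_real (sqrt (2 * pi * T)) :: complex) ^ 2 = of_real (2 * pi * T)"
    using assms by (simp flip: of_real_power)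
  then show ?thesis
    by (simp add: scaled_gauss_deriv_def power_mult_distrib)
qed

lemma scaled_gauss_deriv_bound:
  obtains C where "C > 0"
    "\<And>s x. s > 0 \<Longrightarrow> norm (scaled_gauss_deriv s (Suc k) (of_real x)) \<le> s ^ k * C * (1 / (1 + s\<^sup>2 * x\<^sup>2))"
proof -
  obtain C where C: "C > 0" "\<And>x::real. norm ((deriv ^^ k) (\<lambda>w::complex. exp (- (w ^ 2))) (of_real x)) \<le> C / (1 + x\<^sup>2)"
    by (rule higher_deriv_gaussian_decay[of k]) blast
  have "norm (scaled_gauss_deriv s (Suc k) (of_real x)) \<le> s ^ k * C * (1 / (1 + s\<^sup>2 * x\<^sup>2))" if "s > 0" for s x
    using that mult_left_mono[OF C(2)[of "s * x"], of "s ^ k"]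
    by (simp add: scaled_gauss_deriv_def norm_mult norm_power power_mult_distrib)
  with C(1) that show ?thesis by blast
qed

text \<open>For \<open>k = 0\<close> this is the reason for subtracting \<open>sqrt pi / 2\<close>
  in the definition; the other orders decay by the inverse square bound.\<close>

lemma scaled_gauss_deriv_tendsto_0:
  assumes "s > 0"
  shows "(\<lambda>n. scaled_gauss_deriv s k (of_nat n)) \<longlonglongrightarrow> 0"
proof (cases k)
  case 0
  have "filterlim (\<lambda>n. s * real n) at_top sequentially"
    using assms by real_asymp
  from filterlim_compose[OF gauss_primitive_at_top this]
  have "(\<lambda>n. (gauss_primitive (of_real s * of_nat n) - of_real (sqrt pi / 2)) / of_real s) \<longlonglongrightarrow>
     (of_real (sqrt pi / 2) - of_real (sqrt pi / 2)) / of_real s"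
    using assms by (intro tendsto_intros) auto
  then show ?thesis
    using 0 by (simp add: scaled_gauss_deriv_def)
next
  case (Suc i)
  obtain C where C: "C > 0"
    "\<And>s x. s > 0 \<Longrightarrow> norm (scaled_gauss_deriv s (Suc i) (of_real x)) \<le> s ^ i * C * (1 / (1 + s\<^sup>2 * x\<^sup>2))"
    by (rule scaled_gauss_deriv_bound[of i]) blast
  have "norm (scaled_gauss_deriv s k (of_nat n)) \<le> s ^ i * C * (1 / (1 + s\<^sup>2 * (real n)\<^sup>2))" for n
    using C(2)[OF assms, of "real n"] Suc by simp
  moreover have "(\<lambda>n. s ^ i * C * (1 / (1 + s\<^sup>2 * (real n)\<^sup>2))) \<longlonglongrightarrow> 0"
  proof -
    have "(\<lambda>n. 1 / (1 + s\<^sup>2 * (real n)\<^sup>2)) \<longlonglongrightarrow> 0"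
      using assms by real_asymp
    then show ?thesis
      by (rule tendsto_mult_right_zero)
  qed
  ultimately show ?thesis
    by (rule Lim_null_comparison[OF always_eventually[OF allI]])
qed

lemma twisted_gauss_sum_estimate:
  fixes \<omega> :: complex and \<delta> :: real and b :: "complex fps"
  assumes "norm \<omega> \<le> 1"
    and b: "b * (1 - fps_const \<omega> * fps_exp 1) = fps_X * fps_exp (of_real \<delta>)"
  obtains C where "\<And>T. 0 < T \<Longrightarrow> T \<le> 1 \<Longrightarrow>
      summable (\<lambda>n. \<omega> ^ n * exp (- 2 * of_real pi * of_real T * (of_nat n + of_real \<delta>) ^ 2))"
    and "\<And>T. 0 < T \<Longrightarrow> T \<le> 1 \<Longrightarrow>
      norm ((\<Sum>n. \<omega> ^ n * exp (- 2 * of_real pi * of_real T * (of_nat n + of_real \<delta>) ^ 2))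
            - (\<Sum>k\<le>2 * (N + 2). fps_nth b k * scaled_gauss_deriv (sqrt (2 * pi * T)) k 0)) \<le> C * T ^ (N + 1)"
proof -
  \<comment> \<open>With \<open>s^2 = 2 pi T\<close> the remainder of order \<open>m\<close> carries
    \<open>T ^ (N + 2)\<close>; the exponent \<open>N + 1\<close> remains after the loss of
    \<open>1 / T\<close> in \<open>inverse_one_plus_square_shift\<close>.\<close>
  define m where "m = 2 * (N + 2)"
  define c where "c = 1 + \<bar>\<delta>\<bar>"
  obtain C where C: "C > 0"
    "\<And>s x. s > 0 \<Longrightarrow> norm (scaled_gauss_deriv s (Suc m) (of_real x)) \<le> s ^ m * C * (1 / (1 + s\<^sup>2 * x\<^sup>2))"
    by (rule scaled_gauss_deriv_bound[of m]) blast
  define A where "A = ((\<Sum>k\<le>m. norm (fps_nth b k)) + norm (of_real \<delta> :: complex) ^ m)"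
  define D where "D = A * ((2 * pi) ^ (N + 2) * C * (2 + 2 * c\<^sup>2))"
  define Z where "Z = (\<Sum>n. 1 / (1 + (real n)\<^sup>2))"
  define f where "f = (\<lambda>T n. exp (- 2 * of_real pi * of_real T * (of_nat n + of_real \<delta>) ^ 2) :: complex)"
  have *: "summable (\<lambda>n. \<omega> ^ n * f T n)"
    "norm ((\<Sum>n. \<omega> ^ n * f T n) - (\<Sum>k\<le>m. fps_nth b k * scaled_gauss_deriv (sqrt (2 * pi * T)) k 0))
       \<le> D * Z * T ^ (N + 1)" if T: "0 < T" "T \<le> 1" for T
  proof -
    define s where "s = sqrt (2 * pi * T)"
    have s: "s > 0" "s\<^sup>2 = 2 * pi * T" using T by (simp_all add: s_def)
    have sm: "s ^ m = (2 * pi) ^ (N + 2) * T ^ (N + 1) * T"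
    proof -
      have "s ^ m = (s\<^sup>2) ^ (N + 2)"
        by (simp only: m_def power_mult)
      then show ?thesis by (simp add: s(2) power_mult_distrib)
    qed
    define P where "P = (\<lambda>n::nat. \<Sum>k\<le>m. fps_nth b k * scaled_gauss_deriv s k (of_nat n))"
    have step: "norm (f T n - (P n - \<omega> * P (Suc n))) \<le> D * T ^ (N + 1) * (1 / (1 + (real n)\<^sup>2))" for n
    proof -
      \<comment> \<open>A real segment around \<open>n\<close> whose radius \<open>c\<close> reaches
        both \<open>n + 1\<close> and \<open>n + \<delta>\<close>; the decay of the derivatives is
        available on the real axis.\<close>
      define S where "S = complex_of_real ` {real n - c .. real n + c}"
      have "norm (scaled_gauss_deriv s 1 (of_nat n + of_real \<delta>) - ((\<Sum>k\<le>m. fps_nth b k * scaled_gauss_deriv s k (of_nat n))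
          - \<omega> * (\<Sum>k\<le>m. fps_nth b k * scaled_gauss_deriv s k (of_nat n + 1))))
        \<le> A * ((2 * pi) ^ (N + 2) * T ^ (N + 1) * C * (2 + 2 * c\<^sup>2) * (1 / (1 + (real n)\<^sup>2)))"
        unfolding A_def
      proof (rule twisted_difference_bound[OF b _ assms(1)])
        show "(scaled_gauss_deriv s k has_field_derivative scaled_gauss_deriv s (Suc k) x) (at x)" for k x
          by (rule scaled_gauss_deriv_has_field_derivative[OF s(1)])
        show "convex S"
          unfolding S_def by (intro convex_linear_image bounded_linear.linear bounded_linear_of_real) auto
        show "of_nat n \<in> S"
          unfolding S_def by (rule image_eqI[of _ _ "real n"]) (auto simp: c_def)
        show "of_nat n + 1 \<in> S"
          unfolding S_def by (rule image_eqI[of _ _ "real n + 1"]) (auto simp: c_def)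
        show "of_nat n + of_real \<delta> \<in> S"
          unfolding S_def by (rule image_eqI[of _ _ "real n + \<delta>"]) (auto simp: c_def)
        show "m > 0" by (simp add: m_def)
      next
        fix y assume "y \<in> S"
        then obtain x where x: "y = of_real x" "\<bar>x - real n\<bar> \<le> c" by (auto simp: S_def)
        have "norm (scaled_gauss_deriv s (Suc m) y) \<le> s ^ m * C * (1 / (1 + 2 * pi * T * x\<^sup>2))"
          using C(2)[OF s(1), of x] by (simp add: x(1) s(2))
        also have "\<dots> \<le> s ^ m * C * ((2 + 2 * c\<^sup>2) / T * (1 / (1 + (real n)\<^sup>2)))"
          using s(1) C(1) by (intro mult_left_mono inverse_one_plus_square_shift T x(2)) auto
        also have "\<dots> = (2 * pi) ^ (N + 2) * T ^ (N + 1) * C * (2 + 2 * c\<^sup>2) * (1 / (1 + (real n)\<^sup>2))"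
        proof -
          have "X * T * C * (k / T * y) = X * C * k * y" for X k y :: real
            using T by simp
          then show ?thesis by (simp only: sm)
        qed
        finally show "norm (scaled_gauss_deriv s (Suc m) y) \<le> \<dots>" .
      qed
      moreover have "scaled_gauss_deriv s 1 (of_nat n + of_real \<delta>) = f T n"
        unfolding s_def f_def by (rule scaled_gauss_deriv_1[OF T(1)])
      moreover have "A * ((2 * pi) ^ (N + 2) * T ^ (N + 1) * C * (2 + 2 * c\<^sup>2) * (1 / (1 + (real n)\<^sup>2)))
          = D * T ^ (N + 1) * (1 / (1 + (real n)\<^sup>2))"
        unfolding D_def by (simp only: mult_ac)
      moreover have "P n = (\<Sum>k\<le>m. fps_nth b k * scaled_gauss_deriv s k (of_nat n))"
        "P (Suc n) = (\<Sum>k\<le>m. fps_nth b k * scaled_gauss_deriv s k (of_nat n + 1))"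
        unfolding P_def by (simp_all add: add.commute)
      ultimately show ?thesis
        by (simp only:)
    qed
    have sm: "(\<lambda>n. D * T ^ (N + 1) * (1 / (1 + (real n)\<^sup>2))) sums (D * T ^ (N + 1) * Z)"
      unfolding Z_def by (intro sums_mult summable_sums inverse_one_plus_square_summable)
    have "P \<longlonglongrightarrow> (\<Sum>k\<le>m. fps_nth b k * 0)"
      unfolding P_def by (intro tendsto_intros scaled_gauss_deriv_tendsto_0[OF s(1)])
    then have P: "P \<longlonglongrightarrow> 0" by simp
    show "summable (\<lambda>n. \<omega> ^ n * f T n)"
      by (rule twisted_telescoping_sums(1)[OF assms(1) step sm P])
    show "norm ((\<Sum>n. \<omega> ^ n * f T n) - (\<Sum>k\<le>m. fps_nth b k * scaled_gauss_deriv (sqrt (2 * pi * T)) k 0))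
       \<le> D * Z * T ^ (N + 1)"
      using twisted_telescoping_sums(2)[OF assms(1) step sm P] by (simp add: P_def s_def mult_ac)
  qed
  show ?thesis
    by (rule that[of "D * Z"]) (use * in \<open>simp_all only: f_def m_def\<close>)
qed

text \<open>Derivatives of odd order of the even Gaussian vanish at 0, so only \<open>k = 0\<close>
  and odd \<open>k\<close> contribute. The term \<open>k = 0\<close> is
  \<open>- sqrt pi / (2 s)\<close>, minus the integral over the half-line.\<close>

lemma scaled_gauss_deriv_sum_0:
  fixes b :: "nat \<Rightarrow> complex"
  assumes T: "T > 0"
  shows "(\<Sum>k\<le>2 * n. b k * scaled_gauss_deriv (sqrt (2 * pi * T)) k 0) =
     - b 0 / of_real (2 * sqrt (2 * T)) +
     (\<Sum>a<n. b (2 * a + 1) * fact (2 * a) / fact a * (- 2 * of_real pi * of_real T) ^ a)"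
proof -
  define s where "s = sqrt (2 * pi * T)"
  have s: "s > 0" "s\<^sup>2 = 2 * pi * T" using T by (simp_all add: s_def)
  define g where "g i = b (Suc i) * scaled_gauss_deriv s (Suc i) 0" for i
  have g: "g i = (if even i then b (Suc i) * of_real s ^ i * (fact i * (- 1) ^ (i div 2) / fact (i div 2)) else 0)" for i
    by (simp add: g_def scaled_gauss_deriv_def higher_deriv_gaussian_0)
  have ge: "g (2 * a) = b (2 * a + 1) * fact (2 * a) / fact a * (- 2 * of_real pi * of_real T) ^ a" for a
  proof -
    have "(of_real s :: complex) ^ (2 * a) = of_real ((s\<^sup>2) ^ a)"
      by (simp add: power_mult)
    also have "\<dots> = (2 * of_real pi * of_real T) ^ a"
      by (simp add: s(2))
    finally have "(of_real s :: complex) ^ (2 * a) * (- 1) ^ a = (- 2 * of_real pi * of_real T) ^ a"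
      by (simp flip: power_mult_distrib)
    then show ?thesis
      by (simp add: g mult_ac)
  qed
  have "(\<Sum>k\<le>2 * n. b k * scaled_gauss_deriv s k 0) = b 0 * scaled_gauss_deriv s 0 0 + (\<Sum>i<2 * n. g i)"
    unfolding g_def by (rule sum.atMost_shift)
  also have "(\<Sum>i<2 * n. g i) = (\<Sum>a<n. g (2 * a))"
    by (rule sum_even_indices) (simp add: g)
  also have "scaled_gauss_deriv s 0 0 = - 1 / of_real (2 * sqrt (2 * T))"
  proof -
    have "s = sqrt pi * sqrt (2 * T)"
      by (simp add: s_def real_sqrt_mult mult_ac)
    then have "sqrt pi / 2 / s = 1 / (2 * sqrt (2 * T))"
      using T by (simp add: field_simps)
    moreover have "scaled_gauss_deriv s 0 0 = - of_real (sqrt pi / 2 / s)"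
      by (simp add: scaled_gauss_deriv_def)
    ultimately show ?thesis
      by (metis minus_divide_left of_real_1 of_real_divide)
  qed
  finally show ?thesis
    by (simp add: ge s_def)
qed

theorem twisted_gauss_sum_asymptotics:
  fixes \<omega> :: complex and \<delta> :: real and b :: "complex fps"
  assumes "norm \<omega> \<le> 1"
    and b: "b * (1 - fps_const \<omega> * fps_exp 1) = fps_X * fps_exp (of_real \<delta>)"
  obtains C where "\<And>T. 0 < T \<Longrightarrow> T \<le> 1 \<Longrightarrow>
      summable (\<lambda>n. \<omega> ^ n * exp (- 2 * of_real pi * of_real T * (of_nat n + of_real \<delta>) ^ 2))"
    and "\<And>T. 0 < T \<Longrightarrow> T \<le> 1 \<Longrightarrow>
      norm ((\<Sum>n. \<omega> ^ n * exp (- 2 * of_real pi * of_real T * (of_nat n + of_real \<delta>) ^ 2))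
            - (- fps_nth b 0 / of_real (2 * sqrt (2 * T)) +
               (\<Sum>a=0..N. fps_nth b (2 * a + 1) * fact (2 * a) / fact a * (- 2 * of_real pi * of_real T) ^ a)))
        \<le> C * T ^ (N + 1)"
proof -
  obtain C where C: "\<And>T. 0 < T \<Longrightarrow> T \<le> 1 \<Longrightarrow>
      summable (\<lambda>n. \<omega> ^ n * exp (- 2 * of_real pi * of_real T * (of_nat n + of_real \<delta>) ^ 2))"
    "\<And>T. 0 < T \<Longrightarrow> T \<le> 1 \<Longrightarrow>
      norm ((\<Sum>n. \<omega> ^ n * exp (- 2 * of_real pi * of_real T * (of_nat n + of_real \<delta>) ^ 2))
            - (\<Sum>k\<le>2 * (N + 2). fps_nth b k * scaled_gauss_deriv (sqrt (2 * pi * T)) k 0)) \<le> C * T ^ (N + 1)"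
    by (rule twisted_gauss_sum_estimate[OF assms, where N = N]) blast
  define t where "t a T = fps_nth b (2 * a + 1) * fact (2 * a) / fact a * (- 2 * of_real pi * of_real T) ^ a"
    for a and T :: real
  \<comment> \<open>The operator sum contains one term more than the expansion,
    \<open>a = N + 1\<close>. \<open>K\<close> is the modulus of its coefficient, and the term joins
    the error.\<close>
  define K where "K = norm (fps_nth b (2 * (N + 1) + 1) * fact (2 * (N + 1)) / fact (N + 1) * (- 2 * of_real pi) ^ (N + 1))"
  have K: "norm (t (N + 1) T) = K * T ^ (N + 1)" if "T > 0" for T
  proof -
    have "t (N + 1) T = fps_nth b (2 * (N + 1) + 1) * fact (2 * (N + 1)) / fact (N + 1) * (- 2 * of_real pi) ^ (N + 1) * of_real T ^ (N + 1)"
      unfolding t_def power_mult_distrib by (simp only: mult_ac)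
    then show ?thesis using that unfolding K_def
      by (simp only: norm_mult norm_power norm_of_real abs_of_pos)
  qed
  have main: "norm ((\<Sum>n. \<omega> ^ n * exp (- 2 * of_real pi * of_real T * (of_nat n + of_real \<delta>) ^ 2))
            - (- fps_nth b 0 / of_real (2 * sqrt (2 * T)) + (\<Sum>a=0..N. t a T))) \<le> (C + K) * T ^ (N + 1)"
    if T: "0 < T" "T \<le> 1" for T
  proof -
    define F where "F = (\<Sum>n. \<omega> ^ n * exp (- 2 * of_real pi * of_real T * (of_nat n + of_real \<delta>) ^ 2))"
    define Q where "Q = - fps_nth b 0 / of_real (2 * sqrt (2 * T)) + (\<Sum>a=0..N. t a T)"
    have "(\<Sum>k\<le>2 * (N + 2). fps_nth b k * scaled_gauss_deriv (sqrt (2 * pi * T)) k 0) =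
        - fps_nth b 0 / of_real (2 * sqrt (2 * T)) + (\<Sum>a<N + 2. t a T)"
      unfolding t_def by (rule scaled_gauss_deriv_sum_0[OF T(1)])
    also have "(\<Sum>a<N + 2. t a T) = (\<Sum>a=0..N. t a T) + t (N + 1) T"
      by (simp add: atLeast0AtMost lessThan_Suc_atMost)
    finally have "(\<Sum>k\<le>2 * (N + 2). fps_nth b k * scaled_gauss_deriv (sqrt (2 * pi * T)) k 0) = Q + t (N + 1) T"
      by (simp only: Q_def add.assoc)
    then have "norm (F - (Q + t (N + 1) T)) \<le> C * T ^ (N + 1)"
      using C(2)[OF T] unfolding F_def by simp
    then have "norm (F - Q) \<le> C * T ^ (N + 1) + norm (t (N + 1) T)"
      using norm_triangle_ineq[of "F - (Q + t (N + 1) T)" "t (N + 1) T"] by simp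
    then show ?thesis
      using K[OF T(1)] unfolding F_def Q_def by (simp add: algebra_simps)
  qed
  show ?thesis
    by (rule that[OF C(1), of "C + K"]) (use main in \<open>simp_all only: t_def\<close>)
qed

section \<open>Fourier series and Poisson summation\<close>

text \<open>The closed interval lies inside the open unit disc, where
  \<open>exp (2 pi i w) = 1\<close> holds only at \<open>w = 0\<close>. Holomorphy on that disc thus
  gives smoothness up to both endpoints.\<close>

definition fourier_coeff :: "(complex \<Rightarrow> complex) \<Rightarrow> int \<Rightarrow> complex" where
  "fourier_coeff h n =
     integral {- 1 / 2..1 / 2} (\<lambda>x::real. h (of_real x) * exp (- 2 * of_real pi * \<i> * of_int n * of_real x))"

lemma of_real_in_unit_ball:
  "x \<in> {- 1 / 2..1 / 2} \<Longrightarrow> complex_of_real x \<in> ball 0 1"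
  by (auto simp: abs_real_def)

lemma continuous_on_of_real_unit_interval:
  assumes "h holomorphic_on ball 0 1"
  shows "continuous_on {- 1 / 2..1 / 2} (\<lambda>x::real. h (of_real x))"
  by (rule continuous_on_compose2[OF holomorphic_on_imp_continuous_on[OF assms]])
     (use of_real_in_unit_ball in \<open>auto intro!: continuous_intros\<close>)

lemma fourier_integrable:
  assumes "h holomorphic_on ball 0 1"
  shows "(\<lambda>x::real. h (of_real x) * exp (- 2 * of_real pi * \<i> * of_int n * of_real x)) integrable_on {- 1 / 2..1 / 2}"
  by (intro integrable_continuous_interval continuous_intros continuous_on_of_real_unit_interval assms)

lemma exp_pi_int_eq: "exp (- (of_real pi * (\<i> * of_int n))) = exp (of_real pi * (\<i> * of_int n))"
  unfolding exp_eq by (intro exI[of _ "- n"]) simp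

text \<open>Integration by parts. Periodicity enters only through equal values at the two endpoints,
  where the exponential also takes equal values, so the boundary terms cancel.\<close>

lemma fourier_coeff_deriv:
  assumes h: "h holomorphic_on ball 0 1" and "h (1 / 2) = h (- 1 / 2)"
  shows "fourier_coeff (deriv h) n = 2 * of_real pi * \<i> * of_int n * fourier_coeff h n"
proof -
  define e where "e = (\<lambda>w::complex. exp (- 2 * of_real pi * \<i> * of_int n * w))"
  define c where "c = 2 * of_real pi * \<i> * (of_int n :: complex)"
  have h': "deriv h holomorphic_on ball 0 1"
    by (intro holomorphic_deriv h open_ball)
  have "((\<lambda>x. deriv h (of_real x) * e (of_real x) - c * (h (of_real x) * e (of_real x))) has_integral
          (h (of_real (1/2)) * e (of_real (1/2)) - h (of_real (- 1/2)) * e (of_real (- 1/2)))) {- 1 / 2..1 / 2}"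
  proof (rule fundamental_theorem_of_calculus)
    fix x :: real assume x: "x \<in> {- 1 / 2..1 / 2}"
    have "(h has_field_derivative deriv h (of_real x)) (at (of_real x))"
      using holomorphic_derivI[OF h open_ball of_real_in_unit_ball[OF x]] .
    moreover have "(e has_field_derivative (- c * e (of_real x))) (at (of_real x))"
      unfolding e_def c_def by (auto intro!: derivative_eq_intros)
    ultimately have "((\<lambda>w. h w * e w) has_field_derivative
        deriv h (of_real x) * e (of_real x) + (- c * e (of_real x)) * h (of_real x)) (at (of_real x))"
      by (rule DERIV_mult)
    from has_vector_derivative_real_field[OF this, of "{- 1 / 2..1 / 2}"]
    show "((\<lambda>x. h (of_real x) * e (of_real x)) has_vector_derivative
        deriv h (of_real x) * e (of_real x) - c * (h (of_real x) * e (of_real x))) (at x within {- 1 / 2..1 / 2})"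
      by (simp add: mult_ac)
  qed auto
  moreover have "e (of_real (1/2)) = e (of_real (- 1/2))"
    using exp_pi_int_eq[of n] by (simp add: e_def)
  ultimately have "((\<lambda>x. deriv h (of_real x) * e (of_real x) - c * (h (of_real x) * e (of_real x))) has_integral 0)
      {- 1 / 2..1 / 2}"
    using assms(2) by simp
  moreover have "((\<lambda>x. deriv h (of_real x) * e (of_real x) - c * (h (of_real x) * e (of_real x))) has_integral
      (fourier_coeff (deriv h) n - c * fourier_coeff h n)) {- 1 / 2..1 / 2}"
    unfolding fourier_coeff_def e_def
    by (intro has_integral_diff has_integral_mult_right integrable_integral fourier_integrable h h')
  ultimately have "0 = fourier_coeff (deriv h) n - c * fourier_coeff h n"
    by (rule has_integral_unique)
  then show ?thesis
    by (simp add: c_def)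
qed

lemma fourier_coeff_bounded:
  assumes h: "h holomorphic_on ball 0 1"
  obtains B where "\<And>n. norm (fourier_coeff h n) \<le> B"
proof -
  have "bounded ((\<lambda>x::real. h (of_real x)) ` {- 1 / 2..1 / 2})"
    by (intro compact_imp_bounded compact_continuous_image continuous_on_of_real_unit_interval h) auto
  then obtain B where B: "\<And>x. x \<in> {- 1 / 2..1 / 2} \<Longrightarrow> norm (h (of_real x)) \<le> B"
    unfolding bounded_iff by blast
  have "norm (h (of_real 0)) \<le> B" by (rule B) simp
  then have B0: "B \<ge> 0" using norm_ge_zero order_trans by blast
  have "norm (fourier_coeff h n) \<le> B * measure lborel {- 1 / 2..1 / 2::real}" for n
    unfolding fourier_coeff_def
    by (rule has_integral_bound_real[OF B0 finite.emptyI integrable_integral[OF fourier_integrable[OF h]]])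
       (use B in \<open>simp add: norm_mult\<close>)
  then show ?thesis by (rule that)
qed

text \<open>One integration by parts bounds the coefficient by a constant over \<open>|n|\<close>,
  since the coefficients of the derivative are bounded.\<close>

lemma fourier_coeff_tendsto_0:
  assumes h: "h holomorphic_on ball 0 1" and "h (1 / 2) = h (- 1 / 2)"
  shows "(\<lambda>A::nat. fourier_coeff h (int A)) \<longlonglongrightarrow> 0" "(\<lambda>A::nat. fourier_coeff h (- int A)) \<longlonglongrightarrow> 0"
proof -
  have h': "deriv h holomorphic_on ball 0 1"
    by (intro holomorphic_deriv h open_ball)
  obtain B where B: "\<And>n. norm (fourier_coeff (deriv h) n) \<le> B"
    by (rule fourier_coeff_bounded[OF h']) blast
  have bound: "norm (fourier_coeff h n) \<le> B * (1 / real_of_int \<bar>n\<bar>)" if "n \<noteq> 0" for n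
  proof -
    define X where "X = real_of_int \<bar>n\<bar> * norm (fourier_coeff h n)"
    have "2 * pi * X \<le> B"
      using B[of n] unfolding fourier_coeff_deriv[OF assms] by (simp add: norm_mult X_def)
    moreover have "1 * X \<le> 2 * pi * X"
      using pi_ge_two by (intro mult_right_mono) (auto simp: X_def)
    ultimately have "X \<le> B" by linarith
    then show ?thesis
      using that by (simp add: X_def pos_le_divide_eq mult.commute)
  qed
  have lim: "(\<lambda>A. B * (1 / real A)) \<longlonglongrightarrow> 0"
    by (rule tendsto_mult_right_zero[OF lim_1_over_n])
  have ev: "eventually (\<lambda>A::nat. A \<noteq> 0) sequentially"
    using eventually_gt_at_top[of 0] by (auto elim!: eventually_mono)
  show "(\<lambda>A::nat. fourier_coeff h (int A)) \<longlonglongrightarrow> 0"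
    by (rule Lim_null_comparison[OF eventually_mono[OF ev] lim]) (use bound[of "int _"] in simp)
  show "(\<lambda>A::nat. fourier_coeff h (- int A)) \<longlonglongrightarrow> 0"
    by (rule Lim_null_comparison[OF eventually_mono[OF ev] lim]) (use bound[of "- int _"] in simp)
qed

lemma fourier_coeff_const: "fourier_coeff (\<lambda>_. c) n = (if n = 0 then c else 0)"
proof (cases "n = 0")
  case False
  have "fourier_coeff (deriv (\<lambda>_. c)) n = 2 * of_real pi * \<i> * of_int n * fourier_coeff (\<lambda>_. c) n"
    by (rule fourier_coeff_deriv) auto
  then show ?thesis
    using False by (simp add: fourier_coeff_def)
qed (simp add: fourier_coeff_def)

lemma sum_symmetric_Suc:
  fixes f :: "int \<Rightarrow> 'a::comm_monoid_add"
  shows "(\<Sum>m=- int (Suc K)..int (Suc K). f m) = (\<Sum>m=- int K..int K. f m) + (f (int (Suc K)) + f (- int (Suc K)))"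
proof -
  have "{- int (Suc K)..int (Suc K)} = insert (int (Suc K)) (insert (- int (Suc K)) {- int K..int K})"
    by auto
  then show ?thesis by (simp add: add_ac)
qed

lemma sum_symmetric:
  fixes f :: "int \<Rightarrow> 'a::comm_monoid_add"
  shows "(\<Sum>m=- int K..int K. f m) = f 0 + (\<Sum>n<K. f (int (Suc n)) + f (- int (Suc n)))"
proof (induction K)
  case (Suc K)
  then show ?case
    unfolding sum_symmetric_Suc by (simp only: sum.lessThan_Suc add.assoc)
qed simp

lemma sum_symmetric_telescope:
  fixes c :: "int \<Rightarrow> 'a::ab_group_add"
  shows "(\<Sum>n=- int A..int A. c (n - 1) - c n) = c (- int (Suc A)) - c (int A)"
proof (induction A)
  case (Suc A)
  have "int (Suc A) - 1 = int A" "- int (Suc A) - 1 = - int (Suc (Suc A))"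
    by simp_all
  with Suc show ?case
    unfolding sum_symmetric_Suc by simp
qed simp

text \<open>Chernoff's argument: dividing \<open>h - h 0\<close> by \<open>exp (2 \<pi> i w) - 1\<close> turns the Fourier partial
  sums at \<open>0\<close> into telescoping ones.\<close>

theorem fourier_series_at_0:
  assumes h: "h holomorphic_on ball 0 1" and per: "h (1 / 2) = h (- 1 / 2)"
  shows "(\<lambda>A::nat. \<Sum>n=- int A..int A. fourier_coeff h n) \<longlonglongrightarrow> h 0"
proof -
  define E where "E = (\<lambda>w::complex. exp (2 * of_real pi * \<i> * w))"
  \<comment> \<open>\<open>p\<close> and \<open>q\<close> are the difference quotients at 0 of
    \<open>h\<close> and of \<open>E\<close>, with the removable singularity filled in. Since
    \<open>E\<close> takes the value 1 in the disc only at 0, \<open>q\<close> has no zero there and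
    \<open>g = p / q\<close> is holomorphic.\<close>
  define p where "p = (\<lambda>w. if w = 0 then deriv h 0 else (h w - h 0) / (w - 0))"
  define q where "q = (\<lambda>w. if w = 0 then deriv E 0 else (E w - E 0) / (w - 0))"
  define g where "g = (\<lambda>w. p w / q w)"
  have "p holomorphic_on ball 0 1"
    unfolding p_def by (rule pole_lemma[OF h]) auto
  moreover have "q holomorphic_on ball 0 1"
    unfolding q_def by (rule pole_lemma) (auto simp: E_def intro!: holomorphic_intros)
  moreover have E0: "E 0 = 1" by (simp add: E_def)
  have E1: "E w \<noteq> 1" if "w \<in> ball 0 1" "w \<noteq> 0" for w
  proof
    assume "E w = 1"
    then obtain n :: int where "Re (2 * of_real pi * \<i> * w) = 0" "Im (2 * of_real pi * \<i> * w) = of_int (2 * n) * pi"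
      unfolding E_def exp_eq_1 by blast
    then have "w = of_int n" by (simp add: complex_eq_iff)
    with that show False by auto
  qed
  moreover have "deriv E 0 = 2 * of_real pi * \<i>"
    unfolding E_def by (auto intro!: DERIV_imp_deriv derivative_eq_intros)
  then have q0: "q w \<noteq> 0" if "w \<in> ball 0 1" for w
    using E1[OF that] E0 by (auto simp: q_def)
  ultimately have g: "g holomorphic_on ball 0 1"
    unfolding g_def by (intro holomorphic_on_divide) auto
  have hg: "h w = h 0 + (g w * E w - g w)" if "w \<in> ball 0 1" for w
  proof (cases "w = 0")
    case False
    then have "h w - h 0 = g w * (E w - 1)"
      using E1[OF that] by (simp add: g_def p_def q_def E0)
    then show ?thesis by (simp add: algebra_simps)
  qed (simp add: E0)
  have E2: "E (1 / 2) = -1" "E (- 1 / 2) = -1"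
    by (simp_all add: E_def exp_minus)
  \<comment> \<open>\<open>E\<close> equals -1 at both endpoints, so \<open>h = h 0 - 2 g\<close>
    there and \<open>g\<close> inherits the matching endpoint values.\<close>
  have gper: "g (1 / 2) = g (- 1 / 2)"
  proof -
    have "h (1 / 2) = h 0 + (g (1 / 2) * - 1 - g (1 / 2))" "h (- 1 / 2) = h 0 + (g (- 1 / 2) * - 1 - g (- 1 / 2))"
      using hg[of "1 / 2"] hg[of "- 1 / 2"] unfolding E2 by (simp_all add: norm_divide)
    with per show ?thesis by simp
  qed
  \<comment> \<open>Multiplication by \<open>E\<close> lowers the index of a Fourier coefficient by
    one, so \<open>h - h 0 = g E - g\<close> becomes a difference of neighbouring coefficients of
    \<open>g\<close>.\<close>
  have coeff: "fourier_coeff h n = fourier_coeff (\<lambda>_. h 0) n + (fourier_coeff g (n - 1) - fourier_coeff g n)" for n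
  proof -
    have "fourier_coeff h n = integral {- 1 / 2..1 / 2} (\<lambda>x::real.
        h 0 * exp (- 2 * of_real pi * \<i> * of_int n * of_real x)
        + (g (of_real x) * exp (- 2 * of_real pi * \<i> * of_int (n - 1) * of_real x)
            - g (of_real x) * exp (- 2 * of_real pi * \<i> * of_int n * of_real x)))"
      unfolding fourier_coeff_def
    proof (rule integral_cong)
      fix x :: real assume x: "x \<in> {- 1 / 2..1 / 2}"
      have "E (of_real x) * exp (- 2 * of_real pi * \<i> * of_int n * of_real x) =
          exp (- 2 * of_real pi * \<i> * of_int (n - 1) * of_real x)"
        unfolding E_def exp_add[symmetric] by (rule arg_cong[of _ _ exp]) (simp add: algebra_simps)
      then show "h (of_real x) * exp (- 2 * of_real pi * \<i> * of_int n * of_real x) =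
        h 0 * exp (- 2 * of_real pi * \<i> * of_int n * of_real x)
        + (g (of_real x) * exp (- 2 * of_real pi * \<i> * of_int (n - 1) * of_real x)
            - g (of_real x) * exp (- 2 * of_real pi * \<i> * of_int n * of_real x))"
        by (subst hg[OF of_real_in_unit_ball[OF x]]) (simp only: ring_distribs mult.assoc)
    qed
    also have "\<dots> = fourier_coeff (\<lambda>_. h 0) n + (fourier_coeff g (n - 1) - fourier_coeff g n)"
      unfolding fourier_coeff_def
      by (intro integral_unique has_integral_add has_integral_diff integrable_integral
            fourier_integrable[OF g] fourier_integrable[of "\<lambda>_. h 0"]) auto
    finally show ?thesis .
  qed
  have "(\<Sum>n=- int A..int A. fourier_coeff h n) = h 0 + (fourier_coeff g (- int (Suc A)) - fourier_coeff g (int A))" for A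
    unfolding coeff sum.distrib sum_symmetric_telescope
    by (simp add: fourier_coeff_const)
  moreover have "(\<lambda>A. h 0 + (fourier_coeff g (- int (Suc A)) - fourier_coeff g (int A))) \<longlonglongrightarrow> h 0 + (0 - 0)"
    using fourier_coeff_tendsto_0[OF g gper] LIMSEQ_Suc[OF fourier_coeff_tendsto_0(2)[OF g gper]]
    by (intro tendsto_intros) auto
  ultimately show ?thesis by simp
qed

section \<open>Poisson summation for a complex translate of the Gaussian\<close>

lemma gauss_translate_bound:
  fixes s :: real and c :: complex
  assumes "s > 0"
  obtains K where "\<And>u x. norm u \<le> 1 \<Longrightarrow> x \<noteq> 0 \<Longrightarrow>
    norm (exp (- ((of_real s * (u + of_real x) + c) ^ 2))) \<le> K * (1 / x\<^sup>2)"
proof -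
  define r where "r = s + norm c"
  have "norm (exp (- ((of_real s * (u + of_real x) + c) ^ 2))) \<le> exp (2 * r\<^sup>2) * (2 / s\<^sup>2) * (1 / x\<^sup>2)"
    if "norm u \<le> 1" "x \<noteq> 0" for u :: complex and x :: real
  proof -
    have "norm (of_real s * (u + of_real x) + c - of_real (s * x)) = norm (of_real s * u + c)"
      by (simp add: algebra_simps)
    also have "\<dots> \<le> norm (of_real s * u) + norm c" by (rule norm_triangle_ineq)
    also have "norm (of_real s * u) \<le> s"
      using that assms by (simp add: norm_mult mult_left_le)
    finally have "norm (exp (- ((of_real s * (u + of_real x) + c) ^ 2))) \<le> exp (2 * r\<^sup>2) * exp (- ((s * x)\<^sup>2 / 2))"
      by (intro norm_exp_minus_square_le) (simp add: r_def)
    also have "\<dots> \<le> exp (2 * r\<^sup>2) * (2 / (s * x)\<^sup>2)"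
    proof (rule mult_left_mono)
      have "(s * x)\<^sup>2 / 2 \<le> exp ((s * x)\<^sup>2 / 2)"
        using exp_ge_add_one_self[of "(s * x)\<^sup>2 / 2"] by linarith
      moreover have "(s * x)\<^sup>2 > 0" using assms that by simp
      ultimately show "exp (- ((s * x)\<^sup>2 / 2)) \<le> 2 / (s * x)\<^sup>2"
        unfolding exp_minus by (simp add: divide_simps mult.commute)
    qed simp
    finally show ?thesis
      by (simp add: power_mult_distrib)
  qed
  then show ?thesis by (rule that)
qed

text \<open>Completing the square moves the Gaussian by \<open>pi i n / s\<close> and leaves the
  constant \<open>\<kappa>\<close>. The integral becomes a difference of one primitive at
  \<open>m + 1/2\<close> and \<open>m - 1/2\<close>, so that summation over \<open>m\<close>
  telescopes.\<close>

lemma gauss_integral_shifted: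
  fixes s :: real and c :: complex and m n :: int
  assumes "s > 0"
  defines "\<kappa> \<equiv> exp (2 * of_real pi * \<i> * of_int n * c / of_real s - of_real (pi\<^sup>2 * (of_int n)\<^sup>2 / s\<^sup>2))"
    and "G \<equiv> \<lambda>x. gauss_primitive (of_real s * x + (c + of_real pi * \<i> * of_int n / of_real s)) / of_real s"
  shows "fourier_coeff (\<lambda>w. exp (- ((of_real s * (w + of_int m) + c) ^ 2))) n =
    \<kappa> * (G (of_int m + 1 / 2) - G (of_int m - 1 / 2))"
proof -
  let ?f = "\<lambda>w. exp (- ((of_real s * (w + of_int m) + c) ^ 2)) * exp (- 2 * of_real pi * \<i> * of_int n * w)"
  have f: "?f w = \<kappa> * exp (- ((of_real s * (w + of_int m) + (c + of_real pi * \<i> * of_int n / of_real s)) ^ 2))" for w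
  proof -
    define v where "v = of_real s * (w + of_int m) + c"
    define p where "p = of_real pi * \<i> * of_int n / complex_of_real s"
    \<comment> \<open>Adding the integer \<open>m\<close> changes the exponent by a multiple of
      \<open>2 pi i\<close>; the exponential can then be written in the same variable
      \<open>v\<close> as the Gaussian.\<close>
    have "exp (- 2 * of_real pi * \<i> * of_int n * w) = exp (- 2 * of_real pi * \<i> * of_int n * (w + of_int m))"
      unfolding exp_eq by (intro exI[of _ "m * n"]) (simp add: algebra_simps)
    also have "- 2 * of_real pi * \<i> * of_int n * (w + of_int m) = 2 * p * c - 2 * p * v"
      using assms by (simp add: v_def p_def field_simps)
    finally have "?f w = exp (- (v ^ 2) + (2 * p * c - 2 * p * v))"
      by (simp only: v_def exp_add)
    also have "- (v ^ 2) + (2 * p * c - 2 * p * v) = 2 * p * c + p ^ 2 - (v + p) ^ 2"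
      by (simp add: power2_eq_square algebra_simps)
    also have "exp \<dots> = exp (2 * p * c + p ^ 2) * exp (- ((v + p) ^ 2))"
      by (simp add: exp_diff exp_minus divide_inverse)
    also have "p ^ 2 = - of_real (pi\<^sup>2 * (of_int n)\<^sup>2 / s\<^sup>2)"
      by (simp add: p_def power_divide power_mult_distrib)
    finally show ?thesis
      by (simp add: \<kappa>_def v_def p_def add.assoc mult.assoc)
  qed
  have "((\<lambda>x. ?f (of_real x)) has_integral
      (\<kappa> * G (of_real (1 / 2) + of_int m) - \<kappa> * G (of_real (- 1 / 2) + of_int m))) {- 1 / 2..1 / 2}"
  proof (rule fundamental_theorem_of_calculus)
    fix x :: real
    have "((\<lambda>w. \<kappa> * G (w + of_int m)) has_field_derivative
       \<kappa> * (exp (- ((of_real s * (of_real x + of_int m) + (c + of_real pi * \<i> * of_int n / of_real s)) ^ 2)) * of_real s / of_real s))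
       (at (of_real x))"
      unfolding G_def
      by (intro DERIV_cmult DERIV_cdivide DERIV_chain2[OF gauss_primitive_has_field_derivative])
         (auto intro!: derivative_eq_intros)
    then have "((\<lambda>w. \<kappa> * G (w + of_int m)) has_field_derivative ?f (of_real x)) (at (of_real x))"
      unfolding f using assms(1) by simp
    then show "((\<lambda>x. \<kappa> * G (of_real x + of_int m)) has_vector_derivative ?f (of_real x)) (at x within {- 1 / 2..1 / 2})"
      by (rule has_vector_derivative_real_field)
  qed auto
  then show ?thesis
    unfolding fourier_coeff_def by (simp add: integral_unique algebra_simps)
qed

text \<open>The periodization \<open>h\<close> of the Gaussian is holomorphic as a uniform limit.
  Its value at 0 is the sum over the integers and also the sum of its Fourier series; this common
  value is \<open>L\<close>.\<close>

theorem poisson_summation_gaussian: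
  fixes s :: real and c :: complex
  assumes s: "s > 0"
  obtains L where "(\<lambda>K::nat. \<Sum>m=- int K..int K. exp (- ((of_real s * of_int m + c) ^ 2))) \<longlonglongrightarrow> L"
    and "(\<lambda>A::nat. \<Sum>n=- int A..int A. of_real (sqrt pi / s) *
      exp (2 * of_real pi * \<i> * of_int n * c / of_real s - of_real (pi\<^sup>2 * (of_int n)\<^sup>2 / s\<^sup>2))) \<longlonglongrightarrow> L"
proof -
  define F where "F = (\<lambda>(m::int) u. exp (- ((of_real s * (u + of_int m) + c) ^ 2)))"
  define S where "S = (\<lambda>(K::nat) u. \<Sum>m=- int K..int K. F m u)"
  define h where "h = (\<lambda>u. F 0 u + (\<Sum>n. F (int (Suc n)) u + F (- int (Suc n)) u))"
  have Fhol: "F m holomorphic_on A" for m A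
    unfolding F_def by (intro holomorphic_intros)
  obtain B where B: "\<And>u x. norm u \<le> 1 \<Longrightarrow> x \<noteq> 0 \<Longrightarrow>
    norm (exp (- ((of_real s * (u + of_real x) + c) ^ 2))) \<le> B * (1 / x\<^sup>2)"
    by (rule gauss_translate_bound[OF s, of c]) blast
  have FB: "norm (F m u) \<le> B * (1 / (of_int m)\<^sup>2)" if "norm u \<le> 1" "m \<noteq> 0" for m u
    using B[OF that(1), of "of_int m"] that(2) by (simp add: F_def)
  have "summable (\<lambda>n. 1 / (real n)\<^sup>2)"
    using inverse_power_summable[of 2, where 'a = real] by (simp add: divide_inverse)
  then have sm: "summable (\<lambda>n. 2 * B * (1 / (real (Suc n))\<^sup>2))"
    by (intro summable_mult) (subst summable_Suc_iff)
  have "uniform_limit (cball 0 1) (\<lambda>K u. \<Sum>n<K. F (int (Suc n)) u + F (- int (Suc n)) u)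
      (\<lambda>u. \<Sum>n. F (int (Suc n)) u + F (- int (Suc n)) u) sequentially"
  proof (rule Weierstrass_m_test[OF _ sm])
    fix n and u :: complex assume "u \<in> cball 0 1"
    then have u: "norm u \<le> 1" by simp
    show "norm (F (int (Suc n)) u + F (- int (Suc n)) u) \<le> 2 * B * (1 / (real (Suc n))\<^sup>2)"
      using norm_triangle_mono[OF FB[OF u, of "int (Suc n)"] FB[OF u, of "- int (Suc n)"]]
      unfolding of_int_minus of_int_of_nat_eq power2_minus by simp
  qed
  then have unif: "uniform_limit (cball 0 1) S h sequentially"
    unfolding S_def h_def sum_symmetric
    by (intro uniform_limit_intros)
  have pt: "(\<lambda>K. S K u) \<longlonglongrightarrow> h u" if "u \<in> cball 0 1" for u
    using tendsto_uniform_limitI[OF unif that] .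
  have Shol: "S K holomorphic_on A" for K A
    unfolding S_def by (intro holomorphic_intros Fhol)
  have hol: "h holomorphic_on ball 0 1"
  proof (rule holomorphic_uniform_sequence[OF open_ball Shol])
    fix x :: complex assume "x \<in> ball 0 1"
    then obtain d where "d > 0" "cball x d \<subseteq> ball 0 1"
      by (meson open_contains_cball open_ball)
    then show "\<exists>d>0. cball x d \<subseteq> ball 0 1 \<and> uniform_limit (cball x d) S h sequentially"
      using ball_subset_cball uniform_limit_on_subset[OF unif] by blast
  qed
  \<comment> \<open>Translation by 1 only renumbers the summands, so the symmetric partial sums at
    the two endpoints differ by two outermost terms, which tend to 0.\<close>
  have per: "h (1 / 2) = h (- 1 / 2)"
  proof -
    have "S K (1 / 2) - S K (- 1 / 2) = F (int K) (1 / 2) - F (- int K) (- 1 / 2)" for K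
    proof -
      have shift: "F m (- 1 / 2) = F (m - 1) (1 / 2)" for m
        by (simp add: F_def)
      have "S K (1 / 2) - S K (- 1 / 2) = - (\<Sum>m=- int K..int K. F (m - 1) (1 / 2) - F m (1 / 2))"
        unfolding S_def shift by (simp add: sum_subtractf)
      also have "\<dots> = F (int K) (1 / 2) - F (- int K) (- 1 / 2)"
      proof -
        have "- int K - 1 = - int (Suc K)" by simp
        then show ?thesis
          by (simp only: shift sum_symmetric_telescope[of "\<lambda>m. F m (1 / 2)" K] minus_diff_eq)
      qed
      finally show ?thesis .
    qed
    moreover have lim: "(\<lambda>K. F (int K) (1 / 2)) \<longlonglongrightarrow> 0" "(\<lambda>K. F (- int K) (- 1 / 2)) \<longlonglongrightarrow> 0"
    proof -
      have lim: "(\<lambda>K. B * (1 / (real K)\<^sup>2)) \<longlonglongrightarrow> 0"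
        by real_asymp
      have ev: "eventually (\<lambda>K::nat. K > 0) sequentially"
        by (rule eventually_gt_at_top)
      show "(\<lambda>K. F (int K) (1 / 2)) \<longlonglongrightarrow> 0"
        by (rule Lim_null_comparison[OF eventually_mono[OF ev] lim])
           (use FB[of "1 / 2" "int _"] in \<open>simp add: norm_divide\<close>)
      show "(\<lambda>K. F (- int K) (- 1 / 2)) \<longlonglongrightarrow> 0"
        by (rule Lim_null_comparison[OF eventually_mono[OF ev] lim])
           (use FB[of "- 1 / 2" "- int _"] in \<open>simp add: norm_divide\<close>)
    qed
    ultimately have "(\<lambda>K. S K (1 / 2) - S K (- 1 / 2)) \<longlonglongrightarrow> 0 - 0"
      using tendsto_diff[OF lim] by simp
    moreover have "(\<lambda>K. S K (1 / 2) - S K (- 1 / 2)) \<longlonglongrightarrow> h (1 / 2) - h (- 1 / 2)"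
      by (intro tendsto_diff pt) (auto simp: norm_divide)
    ultimately show ?thesis
      using LIMSEQ_unique by fastforce
  qed
  have coeff: "fourier_coeff h n = of_real (sqrt pi / s) *
      exp (2 * of_real pi * \<i> * of_int n * c / of_real s - of_real (pi\<^sup>2 * (of_int n)\<^sup>2 / s\<^sup>2))" for n
  proof -
    define \<kappa> where "\<kappa> = exp (2 * of_real pi * \<i> * of_int n * c / of_real s - of_real (pi\<^sup>2 * (of_int n)\<^sup>2 / s\<^sup>2))"
    define p where "p = c + of_real pi * \<i> * of_int n / of_real s"
    define G where "G = (\<lambda>x. gauss_primitive (of_real s * x + p) / of_real s)"
    define e where "e = (\<lambda>x::real. exp (- 2 * of_real pi * \<i> * of_int n * of_real x))"
    have ne: "norm (e x) = 1" for x by (simp add: e_def)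
    have "uniform_limit {- 1 / 2..1 / 2} (\<lambda>K x. S K (of_real x) * e x) (\<lambda>x. h (of_real x) * e x) sequentially"
    proof (rule uniform_limitI)
      fix \<epsilon> :: real assume "\<epsilon> > 0"
      from uniform_limitD[OF unif this]
      show "\<forall>\<^sub>F K in sequentially. \<forall>x\<in>{- 1 / 2..1 / 2}. dist (S K (of_real x) * e x) (h (of_real x) * e x) < \<epsilon>"
      proof (rule eventually_mono, intro ballI)
        fix K and x :: real
        assume *: "\<forall>u\<in>cball 0 1. dist (S K u) (h u) < \<epsilon>" and "x \<in> {- 1 / 2..1 / 2}"
        from this(2) have "of_real x \<in> cball (0::complex) 1"
          using of_real_in_unit_ball ball_subset_cball by blast
        with * show "dist (S K (of_real x) * e x) (h (of_real x) * e x) < \<epsilon>"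
          by (simp add: dist_norm norm_mult ne flip: left_diff_distrib)
      qed
    qed
    moreover have "continuous_on {- 1 / 2..1 / 2} (\<lambda>x. S K (of_real x) * e x)" for K
      unfolding e_def by (intro continuous_intros continuous_on_of_real_unit_interval Shol)
    ultimately obtain I J where IJ: "\<And>K. ((\<lambda>x. S K (of_real x) * e x) has_integral I K) {- 1 / 2..1 / 2}"
      "((\<lambda>x. h (of_real x) * e x) has_integral J) {- 1 / 2..1 / 2}" "I \<longlonglongrightarrow> J"
      by (rule uniform_limit_integral) auto
    have J: "fourier_coeff h n = J"
      using integral_unique[OF IJ(2)] by (simp add: fourier_coeff_def e_def)
    \<comment> \<open>Integrating the partial sum over one period joins the translates into one
      integral of the shifted Gaussian from \<open>-(K + 1/2)\<close> to
      \<open>K + 1/2\<close>.\<close>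
    have I: "I K = \<kappa> * (G (of_nat K + 1 / 2) - G (- (of_nat K + 1 / 2)))" for K
    proof -
      have "((\<lambda>x. \<Sum>m=- int K..int K. F m (of_real x) * e x) has_integral
          (\<Sum>m=- int K..int K. fourier_coeff (F m) n)) {- 1 / 2..1 / 2}"
        unfolding fourier_coeff_def e_def
        by (intro has_integral_sum finite_atLeastAtMost_int integrable_integral fourier_integrable Fhol)
      moreover have "(\<lambda>x. S K (of_real x) * e x) = (\<lambda>x. \<Sum>m=- int K..int K. F m (of_real x) * e x)"
        by (simp add: S_def sum_distrib_right)
      ultimately have "I K = (\<Sum>m=- int K..int K. fourier_coeff (F m) n)"
        using IJ(1)[of K] has_integral_unique by metis
      also have "\<dots> = (\<Sum>m=- int K..int K. \<kappa> * (G (of_int m + 1 / 2) - G (of_int m - 1 / 2)))"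
        unfolding F_def \<kappa>_def G_def p_def by (intro sum.cong refl gauss_integral_shifted s)
      also have "\<dots> = \<kappa> * (- (\<Sum>m=- int K..int K. G (of_int (m - 1) + 1 / 2) - G (of_int m + 1 / 2)))"
      proof -
        have "of_int (m - 1) + 1 / 2 = (of_int m - 1 / 2 :: complex)" for m
          by simp
        then show ?thesis
          by (simp only: sum_distrib_left[symmetric] sum_negf[symmetric] minus_diff_eq)
      qed
      also have "(\<Sum>m=- int K..int K. G (of_int (m - 1) + 1 / 2) - G (of_int m + 1 / 2)) =
          G (of_int (- int (Suc K)) + 1 / 2) - G (of_int (int K) + 1 / 2)"
        by (rule sum_symmetric_telescope[of "\<lambda>m. G (of_int m + 1 / 2)"])
      also have "of_int (- int (Suc K)) + 1 / 2 = (- (of_nat K + 1 / 2) :: complex)"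
        by simp
      finally show ?thesis by simp
    qed
    have "(\<lambda>K. G (of_nat K + 1 / 2)) \<longlonglongrightarrow> of_real (sqrt pi / 2) / of_real s"
    proof -
      have "filterlim (\<lambda>K::nat. s * (real K + 1 / 2)) at_top sequentially"
        using s by real_asymp
      from filterlim_compose[OF gauss_primitive_shifted_at_top[of p] this]
      have "(\<lambda>K. gauss_primitive (of_real s * (of_nat K + 1 / 2) + p)) \<longlonglongrightarrow> of_real (sqrt pi / 2)"
        by simp
      then show ?thesis
        unfolding G_def using s by (intro tendsto_divide tendsto_const) auto
    qed
    \<comment> \<open>Oddness of the primitive reduces the limit at minus infinity to the one at
      plus infinity with \<open>- p\<close> in place of \<open>p\<close>. Together the two limits
      give the factor \<open>sqrt pi / s\<close>.\<close>
    moreover have "(\<lambda>K. G (- (of_nat K + 1 / 2))) \<longlonglongrightarrow> - of_real (sqrt pi / 2) / of_real s"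
    proof -
      have "filterlim (\<lambda>K::nat. s * (real K + 1 / 2)) at_top sequentially"
        using s by real_asymp
      from filterlim_compose[OF gauss_primitive_shifted_at_top[of "- p"] this]
      have "(\<lambda>K. gauss_primitive (of_real s * (of_nat K + 1 / 2) + - p)) \<longlonglongrightarrow> of_real (sqrt pi / 2)"
        by simp
      then have "(\<lambda>K. - gauss_primitive (of_real s * (of_nat K + 1 / 2) + - p) / of_real s) \<longlonglongrightarrow> - of_real (sqrt pi / 2) / of_real s"
        using s by (intro tendsto_divide tendsto_minus tendsto_const) auto
      moreover have "G (- (of_nat K + 1 / 2)) = - gauss_primitive (of_real s * (of_nat K + 1 / 2) + - p) / of_real s" for K
      proof -
        have "of_real s * - (of_nat K + 1 / 2) + p = - (of_real s * (of_nat K + 1 / 2) + - p)"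
          by (simp add: algebra_simps)
        then show ?thesis
          unfolding G_def by (simp only: gauss_primitive_minus)
      qed
      ultimately show ?thesis by simp
    qed
    ultimately have "(\<lambda>K. I K) \<longlonglongrightarrow> \<kappa> * (of_real (sqrt pi / 2) / of_real s - - of_real (sqrt pi / 2) / of_real s)"
      unfolding I by (intro tendsto_mult tendsto_diff tendsto_const)
    then have "J = \<kappa> * (of_real (sqrt pi / 2) / of_real s - - of_real (sqrt pi / 2) / of_real s)"
      using IJ(3) LIMSEQ_unique by blast
    then show ?thesis
      unfolding J \<kappa>_def by (simp add: field_simps)
  qed
  show ?thesis
  proof (rule that)
    show "(\<lambda>K::nat. \<Sum>m=- int K..int K. exp (- ((of_real s * of_int m + c) ^ 2))) \<longlonglongrightarrow> h 0"
      using pt[of 0] by (simp add: S_def F_def)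
    show "(\<lambda>A::nat. \<Sum>n=- int A..int A. of_real (sqrt pi / s) *
      exp (2 * of_real pi * \<i> * of_int n * c / of_real s - of_real (pi\<^sup>2 * (of_int n)\<^sup>2 / s\<^sup>2))) \<longlonglongrightarrow> h 0"
      using fourier_series_at_0[OF hol per] unfolding coeff .
  qed
qed

section \<open>The two specializations of the twisted summation\<close>

lemma twisted_gauss_sum_asymptotics_neq_1:
  fixes \<omega> :: complex and \<delta> :: real
  assumes "norm \<omega> \<le> 1" "\<omega> \<noteq> 1"
  obtains C where "\<And>T. 0 < T \<Longrightarrow> T \<le> 1 \<Longrightarrow>
      summable (\<lambda>n. \<omega> ^ n * exp (- 2 * of_real pi * of_real T * (of_nat n + of_real \<delta>) ^ 2))"
    and "\<And>T. 0 < T \<Longrightarrow> T \<le> 1 \<Longrightarrow>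
      norm ((\<Sum>n. \<omega> ^ n * exp (- 2 * of_real pi * of_real T * (of_nat n + of_real \<delta>) ^ 2))
            - (\<Sum>a=0..N. (deriv ^^ (2 * a)) (\<lambda>u. exp (of_real \<delta> * u) / (1 - \<omega> * exp u)) 0
                 * (- 2 * of_real pi * of_real T) ^ a / fact a))
        \<le> C * T ^ (N + 1)"
proof -
  \<comment> \<open>\<open>G\<close> is a unit because \<open>\<omega> \<noteq> 1\<close>, hence
    \<open>b\<close> is \<open>X\<close> times the Taylor series of
    \<open>exp (\<delta> u) / (1 - \<omega> exp u)\<close>. Its constant coefficient is 0, which
    removes the \<open>1 / sqrt T\<close> term.\<close>
  define G where "G = (1 - fps_const \<omega> * fps_exp 1 :: complex fps)"
  define B where "B = fps_exp (of_real \<delta>) / G"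
  define b where "b = fps_X * B"
  have G0: "fps_nth G 0 \<noteq> 0"
    using assms by (simp add: G_def)
  then have "B * G = fps_exp (of_real \<delta>)"
    by (simp add: B_def fps_divide_unit mult.assoc inverse_mult_eq_1)
  then have b: "b * (1 - fps_const \<omega> * fps_exp 1) = fps_X * fps_exp (of_real \<delta>)"
    by (simp add: b_def mult.assoc flip: G_def)
  have "(\<lambda>u. exp (of_real \<delta> * u) / (1 - \<omega> * exp u)) has_fps_expansion B"
    unfolding B_def using G0 by (intro has_fps_expansion_divide') (auto simp: G_def intro!: fps_expansion_intros)
  then have B: "fps_nth B k = (deriv ^^ k) (\<lambda>u. exp (of_real \<delta> * u) / (1 - \<omega> * exp u)) 0 / fact k" for k
    by (rule fps_nth_fps_expansion)
  have "fps_nth b (2 * a + 1) * fact (2 * a) / fact a * x ^ a =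
     (deriv ^^ (2 * a)) (\<lambda>u. exp (of_real \<delta> * u) / (1 - \<omega> * exp u)) 0 * x ^ a / fact a" for a and x :: complex
    by (simp add: b_def B)
  moreover have "fps_nth b 0 = 0" by (simp add: b_def)
  ultimately have eq: "- fps_nth b 0 / y + (\<Sum>a=0..N. fps_nth b (2 * a + 1) * fact (2 * a) / fact a * x ^ a) =
      (\<Sum>a=0..N. (deriv ^^ (2 * a)) (\<lambda>u. exp (of_real \<delta> * u) / (1 - \<omega> * exp u)) 0 * x ^ a / fact a)" for x y :: complex
    by (simp only:) simp
  show ?thesis
    by (rule twisted_gauss_sum_asymptotics[OF assms(1) b, where N = N], rule that)
       (simp_all only: eq)
qed

lemma bernoulli_poly_0: "bernoulli_poly 0 x = 1"
  using arg_cong[OF bernoulli_poly_egf[of x], of "\<lambda>f. fps_nth f 1"]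
  by (simp add: fps_mult_nth)

lemma gauss_sum_asymptotics_bernoulli:
  fixes \<delta> :: real
  obtains C where "\<And>T. 0 < T \<Longrightarrow> T \<le> 1 \<Longrightarrow>
      summable (\<lambda>n. exp (- 2 * of_real pi * of_real T * (of_nat n + of_real \<delta>) ^ 2) :: complex)"
    and "\<And>T. 0 < T \<Longrightarrow> T \<le> 1 \<Longrightarrow>
      norm ((\<Sum>n. exp (- 2 * of_real pi * of_real T * (of_nat n + of_real \<delta>) ^ 2))
            - (1 / of_real (2 * sqrt (2 * T)) -
               (\<Sum>a=0..N. of_real (bernoulli_poly (2 * a + 1) \<delta>) / of_nat (2 * a + 1)
                 * (- 2 * of_real pi * of_real T) ^ a / fact a)) :: complex)
        \<le> C * T ^ (N + 1)"
proof -
  \<comment> \<open>The sign comes from \<open>1 - exp X = - (exp X - 1)\<close>. The constant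
    coefficient -1 yields the main term, and \<open>(2 a)! / (2 a + 1)!\<close> leaves the
    denominator \<open>2 a + 1\<close>.\<close>
  define b :: "complex fps" where "b = - Abs_fps (\<lambda>n. of_real (bernoulli_poly n \<delta> / fact n))"
  have "Abs_fps (\<lambda>n. of_real (bernoulli_poly n \<delta> / fact n)) * (fps_exp 1 - 1) = (fps_X * fps_exp (of_real \<delta>) :: complex fps)"
  proof (rule fps_ext)
    fix n
    have "fps_nth (Abs_fps (\<lambda>n. of_real (bernoulli_poly n \<delta> / fact n)) * (fps_exp 1 - 1) :: complex fps) n
       = of_real (fps_nth (Abs_fps (\<lambda>n. bernoulli_poly n \<delta> / fact n) * (fps_exp 1 - 1)) n)"
      unfolding fps_mult_nth of_real_sum by (intro sum.cong refl) simp
    also have "\<dots> = of_real (fps_nth (fps_X * fps_exp \<delta>) n)"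
      by (simp only: bernoulli_poly_egf)
    also have "\<dots> = fps_nth (fps_X * fps_exp (of_real \<delta>)) n"
      by simp
    finally show "fps_nth (Abs_fps (\<lambda>n. of_real (bernoulli_poly n \<delta> / fact n)) * (fps_exp 1 - 1) :: complex fps) n = \<dots>" .
  qed
  then have b: "b * (1 - fps_const 1 * fps_exp 1) = fps_X * fps_exp (of_real \<delta>)"
    by (simp add: b_def algebra_simps)
  have "fps_nth b (2 * a + 1) * fact (2 * a) / fact a * x ^ a =
      - (of_real (bernoulli_poly (2 * a + 1) \<delta>) / of_nat (2 * a + 1) * x ^ a / fact a)" for a and x :: complex
  proof -
    have "(fact (2 * a + 1) :: complex) = of_nat (2 * a + 1) * fact (2 * a)"
      by (simp only: Suc_eq_plus1[symmetric] fact_Suc)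
    then have "fps_nth b (2 * a + 1) = - (of_real (bernoulli_poly (2 * a + 1) \<delta>) / (of_nat (2 * a + 1) * fact (2 * a)))"
      by (simp only: b_def fps_neg_nth fps_nth_Abs_fps of_real_divide of_real_fact)
    then show ?thesis
      by (simp only: mult_minus_left minus_divide_left[symmetric]) (simp del: of_nat_add of_nat_Suc)
  qed
  then have "(\<Sum>a=0..N. fps_nth b (2 * a + 1) * fact (2 * a) / fact a * x ^ a) =
      - (\<Sum>a=0..N. of_real (bernoulli_poly (2 * a + 1) \<delta>) / of_nat (2 * a + 1) * x ^ a / fact a)" for x :: complex
    by (simp only: sum_negf)
  moreover have "fps_nth b 0 = - 1"
    by (simp add: b_def bernoulli_poly_0)
  ultimately have eq: "- fps_nth b 0 / y + (\<Sum>a=0..N. fps_nth b (2 * a + 1) * fact (2 * a) / fact a * x ^ a) =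
      1 / y - (\<Sum>a=0..N. of_real (bernoulli_poly (2 * a + 1) \<delta>) / of_nat (2 * a + 1) * x ^ a / fact a)" for x y :: complex
    by (simp only: minus_minus diff_conv_add_uminus)
  have 1: "norm (1 :: complex) \<le> 1" by simp
  show ?thesis
    by (rule twisted_gauss_sum_asymptotics[OF 1 b, where N = N], rule that)
       (simp_all only: eq power_one mult_1_left)
qed

section \<open>Derivatives of the geometric series\<close>

text \<open>The induction runs over all points of the open set, because differentiating once more
  requires agreement in a neighbourhood and not just at \<open>z\<close>.\<close>

lemma D_z_funpow:
  assumes "f holomorphic_on S" "open S" "z \<in> S"
  shows "(D_z ^^ k) f z = (1 / (2 * of_real pi * \<i>)) ^ k * (deriv ^^ k) f z"
  using assms(3)
proof (induction k arbitrary: z)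
  case (Suc k)
  have "eventually (\<lambda>w. w \<in> S) (nhds z)"
    using assms(2) Suc.prems by (rule eventually_nhds_in_open)
  then have "deriv ((D_z ^^ k) f) z = deriv (\<lambda>w. (1 / (2 * of_real pi * \<i>)) ^ k * (deriv ^^ k) f w) z"
    by (intro deriv_cong_ev refl) (auto elim!: eventually_mono simp: Suc.IH)
  also have "\<dots> = (1 / (2 * of_real pi * \<i>)) ^ k * deriv ((deriv ^^ k) f) z"
    using holomorphic_on_imp_differentiable_at[OF holomorphic_higher_deriv[OF assms(1,2)] assms(2) Suc.prems]
    by (rule deriv_cmult)
  finally show ?case
    by (simp add: D_z_def[of "(D_z ^^ k) f"])
qed simp

lemma of_real_of_rat: "of_real (of_rat d) = (of_rat d :: 'a :: real_field)"
  by (cases d) (simp add: of_rat_rat)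

text \<open>Substituting \<open>u = 2 pi i l (w - z)\<close> turns the quotient into
  \<open>epow z d\<close> times the function of \<open>u\<close> to be differentiated at 0. By the
  chain rule each \<open>D_z\<close> contributes a factor \<open>l\<close>.\<close>

lemma D_z_geometric:
  fixes d :: rat and l :: nat
  assumes l: "l \<ge> 1" and z: "epow z (of_nat l) \<noteq> 1"
  shows "(D_z ^^ k) (\<lambda>w. epow w d / (1 - epow w (of_nat l))) z =
    epow z d * of_nat l ^ k *
      (deriv ^^ k) (\<lambda>u. exp (of_real (of_rat d / real l) * u) / (1 - epow z (of_nat l) * exp u)) 0"
proof -
  define c where "c = 2 * of_real pi * \<i> * (of_nat l :: complex)"
  define g where "g = (\<lambda>u. exp (of_real (of_rat d / real l) * u) / (1 - epow z (of_nat l) * exp u))"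
  define G where "G = (\<lambda>w. epow w d / (1 - epow w (of_nat l)))"
  define U where "U = {u. 1 - epow z (of_nat l) * exp u \<noteq> 0}"
  define S where "S = {w. 1 - epow w (of_nat l) \<noteq> 0}"
  have U: "open U"
    unfolding U_def by (intro open_Collect_neq continuous_intros)
  have S: "open S"
    unfolding S_def epow_def by (intro open_Collect_neq continuous_intros)
  have zS: "z \<in> S" using z by (simp add: S_def)
  have g: "g holomorphic_on U"
    unfolding g_def U_def by (intro holomorphic_intros) auto
  have G: "G holomorphic_on S"
    unfolding G_def S_def epow_def by (intro holomorphic_intros) auto
  have e1: "epow w (of_nat l) = epow z (of_nat l) * exp (c * w + - (c * z))" for w
    unfolding epow_def exp_add[symmetric] by (rule arg_cong[of _ _ exp]) (simp add: c_def algebra_simps)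
  have SU: "c * w + - (c * z) \<in> U" if "w \<in> S" for w
    using that unfolding S_def U_def mem_Collect_eq e1[of w, symmetric] .
  have e2: "epow w d = epow z d * exp (of_real (of_rat d / real l) * (c * w + - (c * z)))" for w
  proof -
    have "of_real (of_rat d / real l) * c = 2 * of_real pi * \<i> * of_rat d"
      using l by (simp add: c_def of_real_of_rat)
    then have "of_real (of_rat d / real l) * (c * w + - (c * z)) = 2 * of_real pi * \<i> * of_rat d * (w - z)"
      by (metis (no_types, lifting) mult.assoc add_uminus_conv_diff right_diff_distrib)
    then show ?thesis
      unfolding epow_def exp_add[symmetric] by (intro arg_cong[of _ _ exp]) (simp add: algebra_simps)
  qed
  have "G = (\<lambda>w. epow z d * g (c * w + - (c * z)))"
  proof
    show "G w = epow z d * g (c * w + - (c * z))" for w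
      unfolding G_def g_def by (subst e1, subst e2) simp
  qed
  then have "(deriv ^^ k) G z = (deriv ^^ k) (\<lambda>w. epow z d * g (c * w + - (c * z))) z"
    by simp
  also have "\<dots> = epow z d * (deriv ^^ k) (\<lambda>w. g (c * w + - (c * z))) z"
  proof (rule higher_deriv_cmult[OF _ zS S])
    show "(\<lambda>w. g (c * w + - (c * z))) holomorphic_on S"
      by (rule holomorphic_on_compose_gen[OF _ g, unfolded o_def])
         (use SU in \<open>auto intro!: holomorphic_intros\<close>)
  qed
  also have "(deriv ^^ k) (\<lambda>w. g (c * w + - (c * z))) z = c ^ k * (deriv ^^ k) g (c * z + - (c * z))"
    by (rule higher_deriv_compose_linear'[OF g S U zS SU])
  finally have "(D_z ^^ k) G z = (1 / (2 * of_real pi * \<i>)) ^ k * (epow z d * (c ^ k * (deriv ^^ k) g 0))"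
    using D_z_funpow[OF G S zS, of k] by simp
  also have "\<dots> = epow z d * (1 / (2 * of_real pi * \<i>) * c) ^ k * (deriv ^^ k) g 0"
    unfolding power_mult_distrib by (simp only: mult_ac)
  also have "1 / (2 * of_real pi * \<i>) * c = of_nat l"
    by (simp add: c_def)
  finally show ?thesis by (simp only: G_def g_def)
qed

lemma jacobi_partial_theta_eq:
  fixes d :: rat and l :: nat and t :: real
  assumes l: "l \<ge> 1"
  shows "jacobi_partial_theta d l z (\<i> * of_real t) =
    (\<Sum>n. epow z d * (epow z (of_nat l) ^ n *
       exp (- 2 * of_real pi * of_real ((real l)\<^sup>2 * t) * (of_nat n + of_real (of_rat d / real l)) ^ 2)))"
  unfolding jacobi_partial_theta_def
proof (rule suminf_cong)
  fix n
  have "epow z (of_nat l * of_nat n + d) = epow z d * epow z (of_nat l) ^ n"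
    unfolding epow_def exp_of_nat_mult[symmetric] exp_add[symmetric]
    by (rule arg_cong[of _ _ exp]) (simp add: of_rat_add of_rat_mult algebra_simps)
  moreover have "epow (\<i> * of_real t) ((of_nat l * of_nat n + d)\<^sup>2) =
     exp (- 2 * of_real pi * of_real ((real l)\<^sup>2 * t) * (of_nat n + of_real (of_rat d / real l)) ^ 2)"
  proof -
    have R: "(of_nat l * (of_nat n + of_real (of_rat d / real l))) ^ 2 = (of_rat ((of_nat l * of_nat n + d)\<^sup>2) :: complex)"
      using l by (simp add: of_rat_add of_rat_mult of_rat_power distrib_left of_real_of_rat)
    have "- 2 * of_real pi * of_real ((real l)\<^sup>2 * t) * (of_nat n + of_real (of_rat d / real l)) ^ 2 =
       - 2 * of_real pi * of_real t * (of_nat l * (of_nat n + of_real (of_rat d / real l) :: complex)) ^ 2"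
      by (simp add: power_mult_distrib)
    also have "\<dots> = 2 * of_real pi * \<i> * of_rat ((of_nat l * of_nat n + d)\<^sup>2) * (\<i> * of_real t)"
    proof -
      have "- 2 * p * q * r = 2 * p * \<i> * r * (\<i> * q)" for p q r :: complex
        by (simp add: algebra_simps)
      then show ?thesis unfolding R .
    qed
    finally show ?thesis
      unfolding epow_def by (rule arg_cong[OF sym])
  qed
  ultimately show "epow z (of_nat l * of_nat n + d) * epow (\<i> * of_real t) ((of_nat l * of_nat n + d)\<^sup>2) =
     epow z d * (epow z (of_nat l) ^ n *
       exp (- 2 * of_real pi * of_real ((real l)\<^sup>2 * t) * (of_nat n + of_real (of_rat d / real l)) ^ 2))"
    by (simp only: mult.assoc)
qed

section \<open>The lower half-plane\<close>

lemma power_le_fact_exp: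
  fixes x :: real
  assumes "x \<ge> 0"
  shows "x ^ p \<le> fact p * exp x"
proof -
  have "(\<Sum>n\<in>{p}. x ^ n /\<^sub>R fact n) \<le> (\<Sum>n. x ^ n /\<^sub>R fact n)"
    using assms by (intro sum_le_suminf summable_exp_generic) auto
  then show ?thesis
    by (simp add: exp_def field_simps)
qed

text \<open>The quotient \<open>q\<close> of both sides is at least 1/4 for large
  \<open>|n|\<close>, and positive at the finitely many other admissible \<open>n\<close>;
  \<open>\<kappa>\<close> is the minimum.\<close>

lemma quadratic_gap_lower_bound:
  fixes x0 y0 :: real
  obtains \<kappa> where "\<kappa> > 0"
    "\<And>n::int. \<bar>of_int n + x0\<bar> > \<bar>y0\<bar> \<Longrightarrow> (of_int n + x0)\<^sup>2 - y0\<^sup>2 \<ge> \<kappa> * (1 + (of_int n)\<^sup>2)"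
proof -
  define q where "q = (\<lambda>n::int. ((of_int n + x0)\<^sup>2 - y0\<^sup>2) / (1 + (of_int n)\<^sup>2))"
  \<comment> \<open>Beyond \<open>R\<close> one has \<open>|n + x0| \<ge> 3/4 |n|\<close> and
    \<open>|y0| \<le> 1/4 |n|\<close>, so the gap is at least \<open>n^2 / 2\<close>, which
    dominates \<open>(1 + n^2) / 4\<close>.\<close>
  define R where "R = \<lceil>4 * (1 + \<bar>x0\<bar> + \<bar>y0\<bar>)\<rceil>"
  define J where "J = {n. \<bar>n\<bar> \<le> R \<and> \<bar>of_int n + x0\<bar> > \<bar>y0\<bar>}"
  have pos: "1 + (of_int n)\<^sup>2 > (0::real)" for n :: int
    by (simp add: add_pos_nonneg)
  have "J \<subseteq> {- R..R}" by (auto simp: J_def)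
  then have J: "finite J" by (rule finite_subset) simp
  \<comment> \<open>Inserting 1/4 covers the indices beyond \<open>R\<close> and keeps the minimum
    defined when \<open>J\<close> is empty.\<close>
  define \<kappa> where "\<kappa> = Min (insert (1 / 4) (q ` J))"
  have "q n > 0" if "n \<in> J" for n
    using that pos[of n] abs_le_square_iff[of "of_int n + x0" y0] by (auto simp: q_def J_def)
  then have "\<kappa> > 0" using J by (auto simp: \<kappa>_def)
  moreover have "(of_int n + x0)\<^sup>2 - y0\<^sup>2 \<ge> \<kappa> * (1 + (of_int n)\<^sup>2)" if n: "\<bar>of_int n + x0\<bar> > \<bar>y0\<bar>" for n :: int
  proof (cases "n \<in> J")
    case True
    then have "\<kappa> \<le> q n" using J by (simp add: \<kappa>_def)
    then show ?thesis using pos[of n] by (simp add: q_def pos_le_divide_eq)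
  next
    case False
    define m where "m = \<bar>real_of_int n\<bar>"
    have "\<bar>n\<bar> > R" using False n by (auto simp: J_def)
    then have "real_of_int \<bar>n\<bar> > 4 * (1 + \<bar>x0\<bar> + \<bar>y0\<bar>)"
      unfolding R_def by linarith
    then have m: "m > 4 * (1 + \<bar>x0\<bar> + \<bar>y0\<bar>)" by (simp add: m_def)
    have "3 / 4 * m \<le> \<bar>of_int n + x0\<bar>"
    proof -
      have "m \<le> \<bar>of_int n + x0\<bar> + \<bar>x0\<bar>"
        using abs_triangle_ineq4[of "of_int n + x0" x0] by (simp add: m_def)
      with m abs_ge_zero[of y0] show ?thesis by argo
    qed
    then have "(3 / 4 * m)\<^sup>2 \<le> (of_int n + x0)\<^sup>2"
      using power_mono[of "3 / 4 * m" "\<bar>of_int n + x0\<bar>" 2] by (simp add: m_def)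
    moreover have "\<bar>y0\<bar> \<le> 1 / 4 * m" using m abs_ge_zero[of x0] by argo
    then have "y0\<^sup>2 \<le> (1 / 4 * m)\<^sup>2"
      using power_mono[of "\<bar>y0\<bar>" "1 / 4 * m" 2] by simp
    moreover have "1\<^sup>2 \<le> m\<^sup>2"
      using m by (intro power_mono) auto
    moreover have "m\<^sup>2 = (of_int n)\<^sup>2" by (simp add: m_def)
    ultimately have "(of_int n + x0)\<^sup>2 - y0\<^sup>2 \<ge> 1 / 4 * (1 + (of_int n)\<^sup>2)"
      by (simp add: power_mult_distrib power_divide)
    moreover have "\<kappa> \<le> 1 / 4"
      unfolding \<kappa>_def using J by (intro Min_le) auto
    then have "\<kappa> * (1 + (of_int n)\<^sup>2) \<le> 1 / 4 * (1 + (of_int n)\<^sup>2)"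
      using pos[of n] by (intro mult_right_mono) auto
    ultimately show ?thesis by linarith
  qed
  ultimately show ?thesis by (rule that)
qed

text \<open>Apply \<open>exp (- x) \<le> p! / x^p\<close> with \<open>x\<close> proportional to
  \<open>(1 + n^2) / T\<close>: this produces \<open>T ^ p\<close>, and since \<open>p > 0\<close>
  it leaves a factor \<open>1 / (1 + n^2)\<close> whose sum is bounded uniformly in
  \<open>A\<close>.\<close>

lemma gauss_tail_bound:
  fixes x0 y0 :: real
  assumes "p > 0"
  obtains C where "\<And>T A. 0 < T \<Longrightarrow>
    (\<Sum>n\<in>{n \<in> {- int A..int A}. \<bar>of_int n + x0\<bar> > \<bar>y0\<bar>}. exp (- (pi * ((of_int n + x0)\<^sup>2 - y0\<^sup>2) / (2 * T)))) \<le> C * T ^ p"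
proof -
  obtain \<kappa> where \<kappa>: "\<kappa> > 0"
    "\<And>n::int. \<bar>of_int n + x0\<bar> > \<bar>y0\<bar> \<Longrightarrow> (of_int n + x0)\<^sup>2 - y0\<^sup>2 \<ge> \<kappa> * (1 + (of_int n)\<^sup>2)"
    by (rule quadratic_gap_lower_bound) blast
  define c where "c = pi * \<kappa> / 2"
  define Z where "Z = 1 + 2 * (\<Sum>n. 1 / (1 + (real (Suc n))\<^sup>2))"
  have c: "c > 0" using \<kappa>(1) by (simp add: c_def)
  have summand: "exp (- (pi * ((of_int n + x0)\<^sup>2 - y0\<^sup>2) / (2 * T))) \<le> fact p / c ^ p * T ^ p * (1 / (1 + (of_int n)\<^sup>2))"
    if T: "T > 0" and n: "\<bar>of_int n + x0\<bar> > \<bar>y0\<bar>" for n :: int and T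
  proof -
    define v where "v = 1 + (real_of_int n)\<^sup>2"
    have v: "v \<ge> 1" by (simp add: v_def)
    have "c * v / T \<le> pi * ((of_int n + x0)\<^sup>2 - y0\<^sup>2) / (2 * T)"
      using mult_left_mono[OF \<kappa>(2)[OF n], of "pi / (2 * T)"] T by (simp add: c_def v_def)
    then have "exp (- (pi * ((of_int n + x0)\<^sup>2 - y0\<^sup>2) / (2 * T))) \<le> exp (- (c * v / T))"
      by simp
    also have "\<dots> \<le> fact p / (c * v / T) ^ p"
      using power_le_fact_exp[of "c * v / T" p] c v T
      unfolding exp_minus by (simp add: divide_simps mult.commute mult.left_commute)
    also have "\<dots> = fact p / c ^ p * T ^ p * (1 / v ^ p)"
      using T by (simp add: power_mult_distrib power_divide)
    also have "\<dots> \<le> fact p / c ^ p * T ^ p * (1 / v)"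
      using v assms c T self_le_power[of v p] by (intro mult_left_mono divide_left_mono) auto
    finally show ?thesis by (simp only: v_def)
  qed
  have "(\<Sum>n\<in>{n \<in> {- int A..int A}. \<bar>of_int n + x0\<bar> > \<bar>y0\<bar>}. exp (- (pi * ((of_int n + x0)\<^sup>2 - y0\<^sup>2) / (2 * T))))
      \<le> fact p / c ^ p * Z * T ^ p" if T: "T > 0" for T A
  proof -
    have sZ: "summable (\<lambda>n. 1 / (1 + (real (Suc n))\<^sup>2))"
      using inverse_one_plus_square_summable by (subst summable_Suc_iff)
    have "(\<Sum>n=- int A..int A. 1 / (1 + (real_of_int n)\<^sup>2)) = 1 + (\<Sum>n<A. 2 * (1 / (1 + (real (Suc n))\<^sup>2)))"
      unfolding sum_symmetric of_int_minus of_int_of_nat_eq power2_minus by simp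
    also have "\<dots> = 1 + 2 * (\<Sum>n<A. 1 / (1 + (real (Suc n))\<^sup>2))"
      by (simp only: sum_distrib_left)
    also have "(\<Sum>n<A. 1 / (1 + (real (Suc n))\<^sup>2)) \<le> (\<Sum>n. 1 / (1 + (real (Suc n))\<^sup>2))"
      by (rule sum_le_suminf[OF sZ]) auto
    finally have Z: "(\<Sum>n=- int A..int A. 1 / (1 + (real_of_int n)\<^sup>2)) \<le> Z"
      by (simp add: Z_def)
    have "(\<Sum>n\<in>{n \<in> {- int A..int A}. \<bar>of_int n + x0\<bar> > \<bar>y0\<bar>}. exp (- (pi * ((of_int n + x0)\<^sup>2 - y0\<^sup>2) / (2 * T))))
        \<le> (\<Sum>n\<in>{n \<in> {- int A..int A}. \<bar>of_int n + x0\<bar> > \<bar>y0\<bar>}. fact p / c ^ p * T ^ p * (1 / (1 + (of_int n)\<^sup>2)))"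
      using summand[OF T] by (intro sum_mono) blast
    also have "\<dots> \<le> (\<Sum>n=- int A..int A. fact p / c ^ p * T ^ p * (1 / (1 + (of_int n)\<^sup>2)))"
      using c T by (intro sum_mono2) auto
    also have "\<dots> = fact p / c ^ p * T ^ p * (\<Sum>n=- int A..int A. 1 / (1 + (real_of_int n)\<^sup>2))"
      by (simp only: sum_distrib_left)
    also have "\<dots> \<le> fact p / c ^ p * T ^ p * Z"
      using c T Z by (intro mult_left_mono) auto
    finally show ?thesis by (simp add: mult_ac)
  qed
  then show ?thesis by (rule that)
qed

lemma sum_symmetric_reflect:
  fixes f :: "int \<Rightarrow> 'a::comm_monoid_add"
  shows "(\<Sum>n=- int A..int A. f (- n)) = (\<Sum>n=- int A..int A. f n)"
  by (rule sum.reindex_bij_witness[of _ uminus uminus]) auto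

lemma theta_transformation:
  fixes T \<delta> :: real and z0 :: complex
  assumes T: "T > 0"
  obtains L where "(\<lambda>K::nat. \<Sum>m=- int K..int K. exp (2 * of_real pi * \<i> * z0 * (of_int m + of_real \<delta>)
        - 2 * of_real pi * of_real T * (of_int m + of_real \<delta>) ^ 2)) \<longlonglongrightarrow> L"
    and "(\<lambda>A::nat. of_real (1 / sqrt (2 * T)) * exp (- of_real pi * z0\<^sup>2 / (2 * of_real T)) *
      (\<Sum>n=- int A..int A. exp (- of_real pi * (of_int n)\<^sup>2 / (2 * of_real T)
           - of_real pi * z0 * of_int n / of_real T - 2 * of_real pi * \<i> * of_int n * of_real \<delta>))) \<longlonglongrightarrow> L"
proof -
  define s where "s = sqrt (2 * pi * T)"
  have s: "s > 0" "s\<^sup>2 = 2 * pi * T" using T by (simp_all add: s_def)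
  \<comment> \<open>Chosen by completing the square: the exponent of the theta term equals
    \<open>- (s m + c)^2 - pi z0^2 / (2 T)\<close>, and the last part is split off as
    \<open>D\<close>.\<close>
  define c where "c = of_real (s * \<delta>) - of_real pi * \<i> * z0 / of_real s"
  define D where "D = exp (- of_real pi * z0\<^sup>2 / (2 * of_real T))"
  have s2: "(of_real s :: complex)\<^sup>2 = 2 * of_real pi * of_real T"
    using s(2) by (metis of_real_mult of_real_numeral of_real_power)
  obtain L where L: "(\<lambda>K::nat. \<Sum>m=- int K..int K. exp (- ((of_real s * of_int m + c) ^ 2))) \<longlonglongrightarrow> L"
    "(\<lambda>A::nat. \<Sum>n=- int A..int A. of_real (sqrt pi / s) *
      exp (2 * of_real pi * \<i> * of_int n * c / of_real s - of_real (pi\<^sup>2 * (of_int n)\<^sup>2 / s\<^sup>2))) \<longlonglongrightarrow> L"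
    by (rule poisson_summation_gaussian[OF s(1), of c]) blast
  have e1: "exp (2 * of_real pi * \<i> * z0 * (of_int m + of_real \<delta>)
        - 2 * of_real pi * of_real T * (of_int m + of_real \<delta>) ^ 2) = D * exp (- ((of_real s * of_int m + c) ^ 2))" for m :: int
  proof -
    define w where "w = (of_int m + of_real \<delta> :: complex)"
    define P where "P = of_real pi * \<i> * z0"
    define X where "X = of_real pi * z0\<^sup>2 / (2 * of_real T)"
    have sq: "(r * w - P / r) ^ 2 = r\<^sup>2 * w ^ 2 - 2 * P * w + P ^ 2 / r\<^sup>2" if "r \<noteq> 0" for r
      using that by (simp add: power2_diff power_mult_distrib power_divide)
    have "of_real s * of_int m + c = of_real s * w - P / of_real s"
      by (simp add: c_def w_def P_def distrib_left)
    then have "(of_real s * of_int m + c) ^ 2 = (of_real s)\<^sup>2 * w ^ 2 - 2 * P * w + P ^ 2 / (of_real s)\<^sup>2"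
      using sq[of "of_real s"] s(1) by simp
    also have "P ^ 2 / (of_real s)\<^sup>2 = - X"
      unfolding s2 P_def X_def power_mult_distrib by (simp add: power2_eq_square)
    finally have "- X + - ((of_real s * of_int m + c) ^ 2) = 2 * P * w - 2 * of_real pi * of_real T * w ^ 2"
      unfolding s2 by simp
    moreover have "2 * P * w = 2 * of_real pi * \<i> * z0 * w"
      by (simp only: P_def mult.assoc)
    moreover have "D = exp (- X)"
      by (simp add: D_def X_def)
    ultimately show ?thesis
      unfolding w_def[symmetric] by (simp only: exp_add[symmetric])
  qed
  \<comment> \<open>Poisson summation yields the dual terms with \<open>n\<close> replaced by
    \<open>- n\<close>; the symmetric range of summation absorbs the sign at the end.\<close>
  have e2: "D * (of_real (sqrt pi / s) * exp (2 * of_real pi * \<i> * of_int n * c / of_real s - of_real (pi\<^sup>2 * (of_int n)\<^sup>2 / s\<^sup>2)))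
     = of_real (1 / sqrt (2 * T)) * D * exp (- of_real pi * (of_int (- n))\<^sup>2 / (2 * of_real T)
           - of_real pi * z0 * of_int (- n) / of_real T - 2 * of_real pi * \<i> * of_int (- n) * of_real \<delta>)" for n :: int
  proof -
    have 3: "sqrt pi / s = 1 / sqrt (2 * T)"
      using T by (simp add: s_def real_sqrt_mult)
    have 4: "2 * of_real pi * \<i> * of_int n * c / of_real s - of_real (pi\<^sup>2 * (of_int n)\<^sup>2 / s\<^sup>2) =
      - of_real pi * (of_int (- n))\<^sup>2 / (2 * of_real T)
           - of_real pi * z0 * of_int (- n) / of_real T - 2 * of_real pi * \<i> * of_int (- n) * of_real \<delta>"
    proof -
      have "c / of_real s = of_real \<delta> - of_real pi * \<i> * z0 / (of_real s)\<^sup>2"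
        using s(1) by (simp add: c_def diff_divide_distrib power2_eq_square)
      also have "of_real pi * \<i> * z0 / (of_real s)\<^sup>2 = \<i> * z0 / (2 * of_real T)"
        unfolding s2 by simp
      finally have "2 * of_real pi * \<i> * of_int n * c / of_real s = 2 * of_real pi * \<i> * of_int n * (of_real \<delta> - \<i> * z0 / (2 * of_real T))"
        by (simp only: times_divide_eq_right[symmetric])
      also have "\<dots> = 2 * of_real pi * \<i> * of_int n * of_real \<delta> + of_real pi * z0 * of_int n / of_real T"
      proof -
        have "2 * p * \<i> * k * (x - \<i> * z0 / (2 * y)) = 2 * p * \<i> * k * x + p * z0 * k / y"
          for p k x y :: complex
        proof -
          define u where "u = z0 / (2 * y)"
          have "2 * p * \<i> * k * (\<i> * u) = (\<i> * \<i>) * (2 * p * k * u)"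
            by (simp only: mult_ac)
          also have "\<dots> = - (2 * p * k * u)"
            by simp
          also have "2 * p * k * u = p * z0 * k / y"
            by (simp add: u_def)
          finally have "2 * p * \<i> * k * (\<i> * z0 / (2 * y)) = - (p * z0 * k / y)"
            by (simp only: u_def times_divide_eq_right)
          then show ?thesis by (simp only: right_diff_distrib diff_minus_eq_add)
        qed
        then show ?thesis .
      qed
      finally have 1: "2 * of_real pi * \<i> * of_int n * c / of_real s =
        2 * of_real pi * \<i> * of_int n * of_real \<delta> + of_real pi * z0 * of_int n / of_real T" .
      have 2: "of_real (pi\<^sup>2 * (of_int n)\<^sup>2 / s\<^sup>2) = of_real pi * (of_int n)\<^sup>2 / (2 * of_real T :: complex)"
        unfolding s(2) using T by (simp add: power2_eq_square)
      show ?thesis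
        unfolding 1 2 by simp
    qed
    show ?thesis
      unfolding 3 4 by (simp only: mult.assoc mult.left_commute)
  qed
  show ?thesis
  proof (rule that[of "D * L"])
    show "(\<lambda>K::nat. \<Sum>m=- int K..int K. exp (2 * of_real pi * \<i> * z0 * (of_int m + of_real \<delta>)
        - 2 * of_real pi * of_real T * (of_int m + of_real \<delta>) ^ 2)) \<longlonglongrightarrow> D * L"
      unfolding e1 sum_distrib_left[symmetric] by (intro tendsto_mult tendsto_const L)
    have "(\<lambda>A::nat. D * (\<Sum>n=- int A..int A. of_real (sqrt pi / s) *
      exp (2 * of_real pi * \<i> * of_int n * c / of_real s - of_real (pi\<^sup>2 * (of_int n)\<^sup>2 / s\<^sup>2)))) \<longlonglongrightarrow> D * L"
      by (intro tendsto_mult tendsto_const L)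
    then show "(\<lambda>A::nat. of_real (1 / sqrt (2 * T)) * exp (- of_real pi * z0\<^sup>2 / (2 * of_real T)) *
      (\<Sum>n=- int A..int A. exp (- of_real pi * (of_int n)\<^sup>2 / (2 * of_real T)
           - of_real pi * z0 * of_int n / of_real T - 2 * of_real pi * \<i> * of_int n * of_real \<delta>))) \<longlonglongrightarrow> D * L"
      unfolding D_def[symmetric] sum_distrib_left e2 by (subst sum_symmetric_reflect[symmetric])
  qed
qed

text \<open>With \<open>g u = exp (\<delta> u) / (1 - \<omega> exp u)\<close>, the reflected
  quotient is \<open>- \<omega> * g (- u)\<close>, and derivatives of even order at 0 do not see the
  sign of \<open>u\<close>.\<close>

lemma higher_deriv_geometric_reflect:
  fixes \<omega> :: complex and \<delta> :: real
  assumes "\<omega> \<noteq> 0" "\<omega> \<noteq> 1"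
  shows "inverse \<omega> * (deriv ^^ (2 * a)) (\<lambda>u. exp (of_real (1 - \<delta>) * u) / (1 - inverse \<omega> * exp u)) 0 =
    - (deriv ^^ (2 * a)) (\<lambda>u. exp (of_real \<delta> * u) / (1 - \<omega> * exp u)) 0"
proof -
  define g where "g = (\<lambda>u. exp (of_real \<delta> * u) / (1 - \<omega> * exp u))"
  define U where "U = {u. 1 - \<omega> * exp u \<noteq> 0}"
  define V where "V = {u. 1 - \<omega> * exp (- 1 * u) \<noteq> 0}"
  have U: "open U" and V: "open V"
    unfolding U_def V_def by (intro open_Collect_neq continuous_intros)+
  have g: "g holomorphic_on U"
    unfolding g_def U_def by (intro holomorphic_intros) auto
  have V0: "0 \<in> V" using assms by (simp add: V_def)
  have VU: "- 1 * w \<in> U" if "w \<in> V" for w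
    using that by (simp add: U_def V_def)
  have "(\<lambda>u. exp (of_real (1 - \<delta>) * u) / (1 - inverse \<omega> * exp u)) = (\<lambda>u. - \<omega> * g (- 1 * u))"
  proof
    fix u :: complex
    have "of_real (1 - \<delta>) * u = u + of_real \<delta> * (- 1 * u)"
      by (simp add: algebra_simps)
    then have "exp (of_real (1 - \<delta>) * u) = exp u * exp (of_real \<delta> * (- 1 * u))"
      by (simp only: exp_add)
    moreover have "1 - inverse \<omega> * exp u = - inverse \<omega> * exp u * (1 - \<omega> * exp (- 1 * u))"
      using assms by (simp add: right_diff_distrib exp_minus field_simps)
    ultimately show "exp (of_real (1 - \<delta>) * u) / (1 - inverse \<omega> * exp u) = - \<omega> * g (- 1 * u)"
      using assms by (simp add: g_def divide_inverse)
  qed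
  then have "(deriv ^^ (2 * a)) (\<lambda>u. exp (of_real (1 - \<delta>) * u) / (1 - inverse \<omega> * exp u)) 0 =
      (deriv ^^ (2 * a)) (\<lambda>u. - \<omega> * g (- 1 * u)) 0"
    by simp
  also have "\<dots> = - \<omega> * (deriv ^^ (2 * a)) (\<lambda>u. g (- 1 * u)) 0"
  proof (rule higher_deriv_cmult[OF _ V0 V])
    show "(\<lambda>u. g (- 1 * u)) holomorphic_on V"
      by (rule holomorphic_on_compose_gen[OF _ g, unfolded o_def])
         (use VU in \<open>auto intro!: holomorphic_intros\<close>)
  qed
  also have "(deriv ^^ (2 * a)) (\<lambda>u. g (- 1 * u)) 0 = (- 1) ^ (2 * a) * (deriv ^^ (2 * a)) g (- 1 * 0)"
    by (rule higher_deriv_compose_linear[OF g V U V0 VU])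
  finally show ?thesis
    using assms by (simp add: g_def)
qed

text \<open>Together the exponents are \<open>- pi (z0 + n)^2 / (2 T)\<close> plus an imaginary
  number, and the real part of \<open>(z0 + n)^2\<close> is \<open>(n + x0)^2 - y0^2\<close>. This
  is the origin of the condition on \<open>n\<close> in the main sum.\<close>

lemma norm_theta_dual_term:
  fixes T \<delta> x0 y0 :: real and n :: int
  assumes "T > 0" and z0: "z0 = of_real x0 + \<i> * of_real y0"
  shows "norm (exp (- of_real pi * z0\<^sup>2 / (2 * of_real T)) * exp (- of_real pi * (of_int n)\<^sup>2 / (2 * of_real T)
           - of_real pi * z0 * of_int n / of_real T - 2 * of_real pi * \<i> * of_int n * of_real \<delta>)) =
     exp (- (pi * ((of_int n + x0)\<^sup>2 - y0\<^sup>2) / (2 * T)))"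
proof -
  define r where "r = pi / (2 * T)"
  have r1: "- of_real pi * w / (2 * of_real T) = of_real r * - w" for w :: complex
    by (simp add: r_def)
  have r2: "of_real pi * z0 * of_int n / of_real T = of_real r * (2 * z0 * of_int n)"
    by (simp add: r_def)
  have "- of_real pi * z0\<^sup>2 / (2 * of_real T) + (- of_real pi * (of_int n)\<^sup>2 / (2 * of_real T)
           - of_real pi * z0 * of_int n / of_real T - 2 * of_real pi * \<i> * of_int n * of_real \<delta>) =
       of_real r * - ((z0 + of_int n)\<^sup>2) - of_real (2 * pi * of_int n * \<delta>) * \<i>"
    unfolding r1 r2 power2_sum by (simp add: algebra_simps)
  then have "norm (exp (- of_real pi * z0\<^sup>2 / (2 * of_real T)) * exp (- of_real pi * (of_int n)\<^sup>2 / (2 * of_real T)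
           - of_real pi * z0 * of_int n / of_real T - 2 * of_real pi * \<i> * of_int n * of_real \<delta>)) =
     exp (Re (of_real r * - ((z0 + of_int n)\<^sup>2) - of_real (2 * pi * of_int n * \<delta>) * \<i>))"
    by (simp only: exp_add[symmetric] norm_exp_eq_Re)
  also have "Re (of_real r * - ((z0 + of_int n)\<^sup>2) - of_real (2 * pi * of_int n * \<delta>) * \<i>) = r * - Re ((z0 + of_int n)\<^sup>2)"
    by simp
  also have "Re ((z0 + of_int n)\<^sup>2) = (of_int n + x0)\<^sup>2 - y0\<^sup>2"
    by (simp add: z0 Re_power2 add.commute)
  finally show ?thesis by (simp only: r_def mult_minus_right times_divide_eq_left)
qed

lemma finite_int_abs_shift_le: "finite {n::int. \<bar>of_int n + x0\<bar> \<le> (c::real)}"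
proof (rule finite_subset)
  show "{n::int. \<bar>of_int n + x0\<bar> \<le> c} \<subseteq> {\<lfloor>- c - x0\<rfloor>..\<lceil>c - x0\<rceil>}"
    by (auto simp: abs_le_iff floor_le_iff le_ceiling_iff)
qed simp

lemma theta_dual_sum_truncation:
  fixes \<delta> x0 y0 :: real and z0 :: complex
  assumes z0: "z0 = of_real x0 + \<i> * of_real y0"
  defines "E \<equiv> \<lambda>T (n::int). exp (- of_real pi * (of_int n)\<^sup>2 / (2 * of_real T)
           - of_real pi * z0 * of_int n / of_real T - 2 * of_real pi * \<i> * of_int n * of_real \<delta>)"
    and "\<rho> \<equiv> \<lambda>T. of_real (1 / sqrt (2 * T)) * exp (- of_real pi * z0\<^sup>2 / (2 * of_real T))"
  obtains C where "\<And>T L. 0 < T \<Longrightarrow> T \<le> 1 \<Longrightarrow> (\<lambda>A::nat. \<rho> T * (\<Sum>n=- int A..int A. E T n)) \<longlonglongrightarrow> L \<Longrightarrow>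
     norm (L - \<rho> T * (\<Sum>n\<in>{n. \<bar>of_int n + x0\<bar> \<le> \<bar>y0\<bar>}. E T n)) \<le> C * T ^ (N + 1)"
proof -
  define I where "I = {n::int. \<bar>of_int n + x0\<bar> \<le> \<bar>y0\<bar>}"
  obtain C where C: "\<And>T A. 0 < T \<Longrightarrow>
    (\<Sum>n\<in>{n \<in> {- int A..int A}. \<bar>of_int n + x0\<bar> > \<bar>y0\<bar>}. exp (- (pi * ((of_int n + x0)\<^sup>2 - y0\<^sup>2) / (2 * T)))) \<le> C * T ^ (N + 2)"
    \<comment> \<open>The exponent is one above the target because the prefactor
      \<open>1 / sqrt (2 * T)\<close> is later bounded by \<open>1 / T\<close>.\<close>
    by (rule gauss_tail_bound[of "N + 2" x0 y0]) auto
  have I: "finite I" unfolding I_def by (rule finite_int_abs_shift_le)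
  obtain A0 :: nat where A0: "I \<subseteq> {- int A0..int A0}"
  proof -
    have "\<bar>n\<bar> \<le> (\<Sum>m\<in>I. \<bar>m\<bar>)" if "n \<in> I" for n
      using that I by (intro member_le_sum) auto
    then have "I \<subseteq> {- int (nat (\<Sum>m\<in>I. \<bar>m\<bar>))..int (nat (\<Sum>m\<in>I. \<bar>m\<bar>))}"
      by (auto simp: abs_le_iff) force+
    then show ?thesis by (rule that)
  qed
  have "norm (L - \<rho> T * (\<Sum>n\<in>I. E T n)) \<le> C * T ^ (N + 1)"
    if T: "0 < T" "T \<le> 1" and L: "(\<lambda>A::nat. \<rho> T * (\<Sum>n=- int A..int A. E T n)) \<longlonglongrightarrow> L" for T L
  \<comment> \<open>The estimate is shown for all partial sums whose range contains
    \<open>I\<close>, with a constant independent of \<open>A\<close>, and then passes to the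
    limit.\<close>
  proof (rule Lim_norm_ubound[OF sequentially_bot tendsto_diff[OF L tendsto_const]])
    have "norm (\<rho> T * (\<Sum>n=- int A..int A. E T n) - \<rho> T * (\<Sum>n\<in>I. E T n)) \<le> C * T ^ (N + 1)" if "A \<ge> A0" for A
    proof -
      define J where "J = {n \<in> {- int A..int A}. \<bar>of_int n + x0\<bar> > \<bar>y0\<bar>}"
      have sub: "I \<subseteq> {- int A..int A}" using A0 that by force
      have J: "{- int A..int A} - I = J" by (auto simp: I_def J_def)
      have "(\<Sum>n=- int A..int A. E T n) = (\<Sum>n\<in>J. E T n) + (\<Sum>n\<in>I. E T n)"
        using sum.subset_diff[OF sub, of "E T"] unfolding J by simp
      then have "norm (\<rho> T * (\<Sum>n=- int A..int A. E T n) - \<rho> T * (\<Sum>n\<in>I. E T n)) = norm (\<Sum>n\<in>J. \<rho> T * E T n)"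
        by (simp add: distrib_left sum_distrib_left)
      also have "\<dots> \<le> (\<Sum>n\<in>J. norm (\<rho> T * E T n))" by (rule norm_sum)
      also have "\<dots> = (\<Sum>n\<in>J. 1 / sqrt (2 * T) * exp (- (pi * ((of_int n + x0)\<^sup>2 - y0\<^sup>2) / (2 * T))))"
      proof (rule sum.cong[OF refl])
        fix n
        have "norm (\<rho> T * E T n) = norm (of_real (1 / sqrt (2 * T)) :: complex) *
            norm (exp (- of_real pi * z0\<^sup>2 / (2 * of_real T)) * E T n)"
          unfolding \<rho>_def by (simp only: mult.assoc norm_mult)
        also have "norm (of_real (1 / sqrt (2 * T)) :: complex) = 1 / sqrt (2 * T)"
          using T by (simp only: norm_of_real) simp
        finally show "norm (\<rho> T * E T n) = 1 / sqrt (2 * T) * exp (- (pi * ((of_int n + x0)\<^sup>2 - y0\<^sup>2) / (2 * T)))"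
          unfolding E_def norm_theta_dual_term[OF T(1) z0] .
      qed
      also have "\<dots> = 1 / sqrt (2 * T) * (\<Sum>n\<in>J. exp (- (pi * ((of_int n + x0)\<^sup>2 - y0\<^sup>2) / (2 * T))))"
        by (simp only: sum_distrib_left)
      also have "\<dots> \<le> 1 / T * (\<Sum>n\<in>J. exp (- (pi * ((of_int n + x0)\<^sup>2 - y0\<^sup>2) / (2 * T))))"
      proof (rule mult_right_mono)
        have "T * T \<le> 1 * T" using T by (intro mult_right_mono) auto
        then have "T\<^sup>2 \<le> 2 * T" using T by (simp add: power2_eq_square)
        then have "T \<le> sqrt (2 * T)" by (rule real_le_rsqrt)
        then show "1 / sqrt (2 * T) \<le> 1 / T" using T by (intro divide_left_mono) auto
      qed (simp add: sum_nonneg)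
      also have "\<dots> \<le> 1 / T * (C * T ^ (N + 2))"
        unfolding J_def using T C[OF T(1), of A] by (intro mult_left_mono) auto
      also have "\<dots> = C * T ^ (N + 1)"
        using T by simp
      finally show ?thesis .
    qed
    then show "eventually (\<lambda>A. norm (\<rho> T * (\<Sum>n=- int A..int A. E T n) - \<rho> T * (\<Sum>n\<in>I. E T n)) \<le> C * T ^ (N + 1)) sequentially"
      using eventually_ge_at_top by (rule eventually_mono[rotated])
  qed
  then show ?thesis unfolding I_def by (rule that)
qed

theorem twisted_gauss_sum_lower_half_plane:
  fixes \<delta> x0 y0 :: real and z0 :: complex
  assumes z0: "z0 = of_real x0 + \<i> * of_real y0" and y0: "y0 < 0"
  defines "\<omega> \<equiv> exp (2 * of_real pi * \<i> * z0)"
    and "E \<equiv> \<lambda>T (n::int). exp (- of_real pi * (of_int n)\<^sup>2 / (2 * of_real T)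
           - of_real pi * z0 * of_int n / of_real T - 2 * of_real pi * \<i> * of_int n * of_real \<delta>)"
    and "\<rho> \<equiv> \<lambda>T. of_real (1 / sqrt (2 * T)) * exp (- of_real pi * z0\<^sup>2 / (2 * of_real T))"
    and "\<epsilon> \<equiv> exp (2 * of_real pi * \<i> * z0 * of_real \<delta>)"
  obtains C where "\<And>T. 0 < T \<Longrightarrow> T \<le> 1 \<Longrightarrow>
      summable (\<lambda>n. \<omega> ^ n * exp (- 2 * of_real pi * of_real T * (of_nat n + of_real \<delta>) ^ 2))"
    and "\<And>T. 0 < T \<Longrightarrow> T \<le> 1 \<Longrightarrow>
      norm (\<epsilon> * (\<Sum>n. \<omega> ^ n * exp (- 2 * of_real pi * of_real T * (of_nat n + of_real \<delta>) ^ 2))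
            - (\<rho> T * (\<Sum>n\<in>{n. \<bar>of_int n + x0\<bar> \<le> \<bar>y0\<bar>}. E T n) +
               \<epsilon> * (\<Sum>a=0..N. (deriv ^^ (2 * a)) (\<lambda>u. exp (of_real \<delta> * u) / (1 - \<omega> * exp u)) 0
                 * (- 2 * of_real pi * of_real T) ^ a / fact a)))
        \<le> C * T ^ (N + 1)"
proof -
  \<comment> \<open>The ratio of the sum over the negative integers. Its modulus is below 1, so the
    Euler-Maclaurin result applies to that half, with \<open>1 - \<delta>\<close> in place of
    \<open>\<delta>\<close>.\<close>
  define \<eta> where "\<eta> = inverse \<omega>"
  have \<omega>0: "\<omega> \<noteq> 0" by (simp add: \<omega>_def)
  have "norm \<omega> = exp (- (2 * pi * y0))"
    by (simp add: \<omega>_def z0)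
  moreover have "2 * pi * y0 < 0" using y0 by (simp add: mult_pos_neg)
  ultimately have "norm \<omega> > 1" by simp
  then have \<omega>1: "\<omega> \<noteq> 1" and \<eta>: "norm \<eta> \<le> 1" "\<eta> \<noteq> 1"
    by (auto simp: \<eta>_def norm_inverse inverse_le_1_iff)
  define f where "f = (\<lambda>T n. exp (- 2 * of_real pi * of_real T * (of_nat n + of_real \<delta>) ^ 2) :: complex)"
  define f' where "f' = (\<lambda>T n. exp (- 2 * of_real pi * of_real T * (of_nat n + of_real (1 - \<delta>)) ^ 2) :: complex)"
  define Q where "Q = (\<lambda>T. \<Sum>a=0..N. (deriv ^^ (2 * a)) (\<lambda>u. exp (of_real \<delta> * u) / (1 - \<omega> * exp u)) 0
                 * (- 2 * of_real pi * of_real T) ^ a / fact a)"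
  define Q' where "Q' = (\<lambda>T. \<Sum>a=0..N. (deriv ^^ (2 * a)) (\<lambda>u. exp (of_real (1 - \<delta>) * u) / (1 - \<eta> * exp u)) 0
                 * (- 2 * of_real pi * of_real T) ^ a / fact a)"
  have QQ': "\<eta> * Q' T = - Q T" for T
  proof -
    have "\<eta> * Q' T = (\<Sum>a=0..N. (\<eta> * (deriv ^^ (2 * a)) (\<lambda>u. exp (of_real (1 - \<delta>) * u) / (1 - \<eta> * exp u)) 0)
                 * (- 2 * of_real pi * of_real T) ^ a / fact a)"
      unfolding Q'_def sum_distrib_left times_divide_eq_right[symmetric] mult.assoc ..
    also have "\<dots> = - Q T"
      unfolding \<eta>_def higher_deriv_geometric_reflect[OF \<omega>0 \<omega>1] Q_def
      by (simp only: mult_minus_left minus_divide_left[symmetric] sum_negf)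
    finally show ?thesis .
  qed
  obtain C1 where C1: "\<And>T. 0 < T \<Longrightarrow> T \<le> 1 \<Longrightarrow> summable (\<lambda>n. \<eta> ^ n * f' T n)"
    "\<And>T. 0 < T \<Longrightarrow> T \<le> 1 \<Longrightarrow> norm ((\<Sum>n. \<eta> ^ n * f' T n) - Q' T) \<le> C1 * T ^ (N + 1)"
    unfolding f'_def Q'_def by (rule twisted_gauss_sum_asymptotics_neq_1[OF \<eta>, of "1 - \<delta>" N]) blast
  obtain C2 where C2: "\<And>T L. 0 < T \<Longrightarrow> T \<le> 1 \<Longrightarrow> (\<lambda>A::nat. \<rho> T * (\<Sum>n=- int A..int A. E T n)) \<longlonglongrightarrow> L \<Longrightarrow>
     norm (L - \<rho> T * (\<Sum>n\<in>{n. \<bar>of_int n + x0\<bar> \<le> \<bar>y0\<bar>}. E T n)) \<le> C2 * T ^ (N + 1)"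
    unfolding E_def \<rho>_def by (rule theta_dual_sum_truncation[OF z0, where N = N and \<delta> = \<delta>]) blast
  have main: "summable (\<lambda>n. \<omega> ^ n * f T n)"
    "norm (\<epsilon> * (\<Sum>n. \<omega> ^ n * f T n) - (\<rho> T * (\<Sum>n\<in>{n. \<bar>of_int n + x0\<bar> \<le> \<bar>y0\<bar>}. E T n) + \<epsilon> * Q T))
       \<le> (C2 + norm (\<epsilon> * \<eta>) * C1) * T ^ (N + 1)" if T: "0 < T" "T \<le> 1" for T
  proof -
    define \<Theta> where "\<Theta> = (\<lambda>m::int. exp (2 * of_real pi * \<i> * z0 * (of_int m + of_real \<delta>)
        - 2 * of_real pi * of_real T * (of_int m + of_real \<delta>) ^ 2))"
    obtain L where L: "(\<lambda>K::nat. \<Sum>m=- int K..int K. \<Theta> m) \<longlonglongrightarrow> L"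
      "(\<lambda>A::nat. \<rho> T * (\<Sum>n=- int A..int A. E T n)) \<longlonglongrightarrow> L"
      unfolding \<Theta>_def \<rho>_def E_def by (rule theta_transformation[OF T(1), of z0 \<delta>]) blast
    have pos: "\<Theta> (int n) = \<epsilon> * (\<omega> ^ n * f T n)" for n
      unfolding \<Theta>_def \<epsilon>_def \<omega>_def f_def exp_of_nat_mult[symmetric] exp_add[symmetric]
      by (rule arg_cong[of _ _ exp]) (simp add: algebra_simps)
    \<comment> \<open>The index \<open>- (n + 1)\<close> gives
      \<open>- (n + 1) + \<delta> = - (n + (1 - \<delta>))\<close>; the square ignores the sign, and
      starting at -1 instead of 0 leaves the extra factor \<open>\<eta>\<close>.\<close>
    have neg: "\<Theta> (- int (Suc n)) = \<epsilon> * \<eta> * (\<eta> ^ n * f' T n)" for n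
    proof -
      have eta: "\<eta> = exp (- (2 * of_real pi * \<i> * z0))"
        by (simp add: \<eta>_def \<omega>_def exp_minus)
      have "of_int (- int (Suc n)) + of_real \<delta> = - (of_nat n + of_real (1 - \<delta>) :: complex)"
        by simp
      then have "\<Theta> (- int (Suc n)) = exp (2 * of_real pi * \<i> * z0 * - (of_nat n + of_real (1 - \<delta>))
        - 2 * of_real pi * of_real T * (of_nat n + of_real (1 - \<delta>)) ^ 2)"
        unfolding \<Theta>_def by (simp only: power2_minus)
      also have "\<dots> = \<epsilon> * \<eta> * (\<eta> ^ n * f' T n)"
        unfolding \<epsilon>_def eta f'_def exp_of_nat_mult[symmetric] exp_add[symmetric]
        by (rule arg_cong[of _ _ exp]) (simp add: algebra_simps)
      finally show ?thesis .
    qed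
    define S' where "S' = (\<Sum>n. \<eta> ^ n * f' T n)"
    \<comment> \<open>The range from \<open>- K\<close> to \<open>K\<close> holds
      \<open>K + 1\<close> nonnegative but only \<open>K\<close> negative indices; the shift is
      undone below by \<open>LIMSEQ_imp_Suc\<close>. Convergence of the growing-weight half is
      thereby deduced from the other two limits.\<close>
    have split: "(\<Sum>n<Suc K. \<Theta> (int n)) = (\<Sum>m=- int K..int K. \<Theta> m) - (\<Sum>n<K. \<Theta> (- int (Suc n)))" for K
      unfolding sum_symmetric sum.distrib sum.lessThan_Suc_shift by simp
    have "(\<lambda>n. \<Theta> (- int (Suc n))) sums (\<epsilon> * \<eta> * S')"
      unfolding neg S'_def by (intro sums_mult summable_sums C1(1) T)
    then have "(\<lambda>K. \<Sum>n<Suc K. \<Theta> (int n)) \<longlonglongrightarrow> L - \<epsilon> * \<eta> * S'"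
      unfolding split sums_def by (intro tendsto_diff L)
    then have sums: "(\<lambda>n. \<epsilon> * (\<omega> ^ n * f T n)) sums (L - \<epsilon> * \<eta> * S')"
      unfolding pos sums_def by (rule LIMSEQ_imp_Suc)
    have \<epsilon>: "\<epsilon> \<noteq> 0" by (simp add: \<epsilon>_def)
    show sm: "summable (\<lambda>n. \<omega> ^ n * f T n)"
      using sums_summable[OF sums] \<epsilon> by (simp add: summable_cmult_iff)
    have "\<epsilon> * (\<Sum>n. \<omega> ^ n * f T n) = L - \<epsilon> * \<eta> * S'"
      using sums_unique[OF sums] suminf_mult[OF sm, of \<epsilon>] by simp
    moreover have "\<epsilon> * Q T = - (\<epsilon> * \<eta> * Q' T)"
      using QQ'[of T] by (simp add: mult.assoc)
    ultimately have "\<epsilon> * (\<Sum>n. \<omega> ^ n * f T n) - (\<rho> T * (\<Sum>n\<in>{n. \<bar>of_int n + x0\<bar> \<le> \<bar>y0\<bar>}. E T n) + \<epsilon> * Q T)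
       = (L - \<rho> T * (\<Sum>n\<in>{n. \<bar>of_int n + x0\<bar> \<le> \<bar>y0\<bar>}. E T n)) - \<epsilon> * \<eta> * (S' - Q' T)"
      by (simp add: right_diff_distrib)
    also have "norm \<dots> \<le> norm (L - \<rho> T * (\<Sum>n\<in>{n. \<bar>of_int n + x0\<bar> \<le> \<bar>y0\<bar>}. E T n)) + norm (\<epsilon> * \<eta>) * norm (S' - Q' T)"
      by (rule order_trans[OF norm_triangle_ineq4]) (simp add: norm_mult)
    also have "\<dots> \<le> C2 * T ^ (N + 1) + norm (\<epsilon> * \<eta>) * (C1 * T ^ (N + 1))"
      unfolding S'_def by (intro add_mono mult_left_mono C2 C1 T L) simp
    finally show "norm (\<epsilon> * (\<Sum>n. \<omega> ^ n * f T n) - (\<rho> T * (\<Sum>n\<in>{n. \<bar>of_int n + x0\<bar> \<le> \<bar>y0\<bar>}. E T n) + \<epsilon> * Q T))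
       \<le> (C2 + norm (\<epsilon> * \<eta>) * C1) * T ^ (N + 1)"
      by (simp only: distrib_right mult.assoc)
  qed
  show ?thesis
    by (rule that[of "C2 + norm (\<epsilon> * \<eta>) * C1"]) (use main in \<open>simp_all only: f_def Q_def\<close>)
qed

section \<open>Asymptotics of the partial theta function\<close>

lemma bigo_at_right_0_scaledI:
  fixes f :: "real \<Rightarrow> complex" and r :: real
  assumes "r > 0" and "\<And>t. 0 < t \<Longrightarrow> r * t \<le> 1 \<Longrightarrow> norm (f t) \<le> C * (r * t) ^ n"
  shows "f \<in> O[at_right 0](\<lambda>t. of_real t ^ n)"
proof (rule bigoI)
  show "eventually (\<lambda>t. norm (f t) \<le> C * r ^ n * norm ((of_real t :: complex) ^ n)) (at_right 0)"
  proof (rule eventually_at_rightI[of 0 "1 / r"])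
    fix t assume "t \<in> {0<..<1 / r}"
    with assms(1) have "0 < t" "r * t \<le> 1" by (auto simp: field_simps)
    with assms(2)[of t] show "norm (f t) \<le> C * r ^ n * norm ((of_real t :: complex) ^ n)"
      by (simp add: norm_power power_mult_distrib mult.assoc)
  qed (use assms in auto)
qed

lemma epow_eq_1_iff:
  assumes "l \<ge> 1"
  shows "epow z (of_nat l) = 1 \<longleftrightarrow> z \<in> range (\<lambda>k::int. of_int k / of_nat l)"
proof
  assume "epow z (of_nat l) = 1"
  then obtain k :: int where "Re (2 * of_real pi * \<i> * of_nat l * z) = 0"
      "Im (2 * of_real pi * \<i> * of_nat l * z) = of_int (2 * k) * pi"
    unfolding epow_def exp_eq_1 by auto
  then have "of_nat l * z = of_int k"
    using assms by (simp add: complex_eq_iff)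
  then have "z = of_int k / of_nat l"
    using assms by (simp add: field_simps)
  then show "z \<in> range (\<lambda>k::int. of_int k / of_nat l)" by blast
next
  assume "z \<in> range (\<lambda>k::int. of_int k / of_nat l)"
  then obtain k :: int where "z = of_int k / of_nat l" by blast
  with assms show "epow z (of_nat l) = 1"
    by (simp add: epow_def exp_eq_1)
qed

lemma norm_epow_of_nat: "norm (epow z (of_nat l)) = exp (- (2 * pi * real l * Im z))"
  by (simp add: epow_def)

text \<open>The factor \<open>l ^ (2 * a)\<close> from the derivatives is exactly what turns
  \<open>t ^ a\<close> into \<open>(l^2 t) ^ a\<close>.\<close>

lemma D_z_geometric_sum:
  fixes d :: rat and l :: nat and t :: real
  assumes "l \<ge> 1" "epow z (of_nat l) \<noteq> 1"
  shows "(\<Sum>a=0..N. (D_z ^^ (2 * a)) (\<lambda>w. epow w d / (1 - epow w (of_nat l))) z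
               * (- 2 * of_real pi * of_real t) ^ a / fact a) =
    epow z d * (\<Sum>a=0..N. (deriv ^^ (2 * a)) (\<lambda>u. exp (of_real (of_rat d / real l) * u) / (1 - epow z (of_nat l) * exp u)) 0
               * (- 2 * of_real pi * of_real ((real l)\<^sup>2 * t)) ^ a / fact a)"
  unfolding D_z_geometric[OF assms] sum_distrib_left
proof (rule sum.cong[OF refl])
  fix a
  define g where "g = (deriv ^^ (2 * a)) (\<lambda>u. exp (of_real (of_rat d / real l) * u) / (1 - epow z (of_nat l) * exp u)) 0"
  have "- 2 * of_real pi * of_real ((real l)\<^sup>2 * t) = (of_nat l)\<^sup>2 * (- 2 * of_real pi * of_real t :: complex)"
    by simp
  then have "(- 2 * of_real pi * of_real ((real l)\<^sup>2 * t)) ^ a = of_nat l ^ (2 * a) * (- 2 * of_real pi * of_real t :: complex) ^ a"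
    by (simp only: power_mult_distrib power_mult)
  then show "epow z d * of_nat l ^ (2 * a) * g * (- 2 * of_real pi * of_real t) ^ a / fact a =
      epow z d * (g * (- 2 * of_real pi * of_real ((real l)\<^sup>2 * t)) ^ a / fact a)"
    by (simp only: times_divide_eq_right mult_ac)
qed

lemma powr_minus_half_eq:
  assumes "t > 0" "l \<ge> 1"
  shows "(2 * (real l)\<^sup>2 * t) powr (- 1 / 2) = 1 / sqrt (2 * ((real l)\<^sup>2 * t))"
proof -
  have "(2 * (real l)\<^sup>2 * t) powr (- (1 / 2)) = 1 / (2 * (real l)\<^sup>2 * t) powr (1 / 2)"
    by (rule powr_minus_divide)
  also have "(2 * (real l)\<^sup>2 * t) powr (1 / 2) = sqrt (2 * (real l)\<^sup>2 * t)"
    using assms by (intro powr_half_sqrt) simp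
  finally show ?thesis by (simp add: mult.assoc)
qed

text \<open>\<open>Im z \<ge> 0\<close> means \<open>norm \<omega> \<le> 1\<close>, so the real
  points off the lattice are handled together with the open upper half-plane.\<close>

lemma jacobi_partial_theta_asymptotics_closed_upper:
  fixes d :: rat
  assumes l: "l \<ge> 1" and "epow z (of_nat l) \<noteq> 1" and "Im z \<ge> 0"
  shows "(\<lambda>t::real. jacobi_partial_theta d l z (\<i> * of_real t)
          - (\<Sum>a=0..N. (D_z ^^ (2 * a)) (\<lambda>w. epow w d / (1 - epow w (of_nat l))) z
               * (- 2 * of_real pi * of_real t) ^ a / fact a))
        \<in> O[at_right 0](\<lambda>t. of_real t ^ (N + 1))"
proof -
  define \<delta> where "\<delta> = of_rat d / real l"
  define \<omega> where "\<omega> = epow z (of_nat l)"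
  have "norm \<omega> \<le> 1"
    using assms by (simp add: \<omega>_def norm_epow_of_nat)
  then obtain C where C: "\<And>T. 0 < T \<Longrightarrow> T \<le> 1 \<Longrightarrow>
      summable (\<lambda>n. \<omega> ^ n * exp (- 2 * of_real pi * of_real T * (of_nat n + of_real \<delta>) ^ 2))"
    "\<And>T. 0 < T \<Longrightarrow> T \<le> 1 \<Longrightarrow>
      norm ((\<Sum>n. \<omega> ^ n * exp (- 2 * of_real pi * of_real T * (of_nat n + of_real \<delta>) ^ 2))
            - (\<Sum>a=0..N. (deriv ^^ (2 * a)) (\<lambda>u. exp (of_real \<delta> * u) / (1 - \<omega> * exp u)) 0
                 * (- 2 * of_real pi * of_real T) ^ a / fact a)) \<le> C * T ^ (N + 1)"
    using twisted_gauss_sum_asymptotics_neq_1[of \<omega> \<delta> N] assms(2) unfolding \<omega>_def by blast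
  show ?thesis
  proof (rule bigo_at_right_0_scaledI[of "(real l)\<^sup>2" _ "norm (epow z d) * C"])
    show "(real l)\<^sup>2 > 0" using l by simp
    fix t :: real assume t: "0 < t" "(real l)\<^sup>2 * t \<le> 1"
    then have T: "0 < (real l)\<^sup>2 * t" using l by simp
    have "norm (epow z d) * norm ((\<Sum>n. \<omega> ^ n * exp (- 2 * of_real pi * of_real ((real l)\<^sup>2 * t) * (of_nat n + of_real \<delta>) ^ 2))
            - (\<Sum>a=0..N. (deriv ^^ (2 * a)) (\<lambda>u. exp (of_real \<delta> * u) / (1 - \<omega> * exp u)) 0
                 * (- 2 * of_real pi * of_real ((real l)\<^sup>2 * t)) ^ a / fact a)) \<le> norm (epow z d) * (C * ((real l)\<^sup>2 * t) ^ (N + 1))"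
      by (intro mult_left_mono C(2) T t) simp
    then show "norm (jacobi_partial_theta d l z (\<i> * of_real t)
          - (\<Sum>a=0..N. (D_z ^^ (2 * a)) (\<lambda>w. epow w d / (1 - epow w (of_nat l))) z
               * (- 2 * of_real pi * of_real t) ^ a / fact a)) \<le> norm (epow z d) * C * ((real l)\<^sup>2 * t) ^ (N + 1)"
      unfolding jacobi_partial_theta_eq[OF l] D_z_geometric_sum[OF assms(1,2)] \<delta>_def[symmetric] \<omega>_def[symmetric]
        suminf_mult[OF C(1)[OF T t(2)]] right_diff_distrib[symmetric] norm_mult mult.assoc[of "norm (epow z d)"] .
  qed
qed

lemma jacobi_partial_theta_asymptotics_lattice:
  fixes d :: rat
  assumes l: "l \<ge> 1" and "epow z (of_nat l) = 1"
  shows "(\<lambda>t::real. jacobi_partial_theta d l z (\<i> * of_real t)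
          - (1 / 2 * of_real ((2 * (real l)\<^sup>2 * t) powr (- 1 / 2)) * epow z d
             - epow z d * (\<Sum>a=0..N. of_real (bernoulli_poly (2 * a + 1) (of_rat d / real l))
                  / of_nat (2 * a + 1)
                  * (- 2 * of_real pi * (of_nat l)\<^sup>2 * of_real t) ^ a / fact a)))
        \<in> O[at_right 0](\<lambda>t. of_real t ^ (N + 1))"
proof -
  define \<delta> where "\<delta> = of_rat d / real l"
  obtain C where C: "\<And>T. 0 < T \<Longrightarrow> T \<le> 1 \<Longrightarrow>
      summable (\<lambda>n. exp (- 2 * of_real pi * of_real T * (of_nat n + of_real \<delta>) ^ 2) :: complex)"
    "\<And>T. 0 < T \<Longrightarrow> T \<le> 1 \<Longrightarrow>
      norm ((\<Sum>n. exp (- 2 * of_real pi * of_real T * (of_nat n + of_real \<delta>) ^ 2))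
            - (1 / of_real (2 * sqrt (2 * T)) -
               (\<Sum>a=0..N. of_real (bernoulli_poly (2 * a + 1) \<delta>) / of_nat (2 * a + 1)
                 * (- 2 * of_real pi * of_real T) ^ a / fact a)) :: complex) \<le> C * T ^ (N + 1)"
    by (rule gauss_sum_asymptotics_bernoulli[of \<delta> N]) blast
  show ?thesis
  proof (rule bigo_at_right_0_scaledI[of "(real l)\<^sup>2" _ "norm (epow z d) * C"])
    show "(real l)\<^sup>2 > 0" using l by simp
    fix t :: real assume t: "0 < t" "(real l)\<^sup>2 * t \<le> 1"
    then have T: "0 < (real l)\<^sup>2 * t" using l by simp
    define Q :: complex where "Q = (\<Sum>a=0..N. of_real (bernoulli_poly (2 * a + 1) \<delta>) / of_nat (2 * a + 1)
                 * (- 2 * of_real pi * of_real ((real l)\<^sup>2 * t)) ^ a / fact a)"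
    have "- 2 * of_real pi * (of_nat l)\<^sup>2 * of_real t = (- 2 * of_real pi * of_real ((real l)\<^sup>2 * t) :: complex)"
      by simp
    then have Q: "(\<Sum>a=0..N. of_real (bernoulli_poly (2 * a + 1) (of_rat d / real l)) / of_nat (2 * a + 1)
                  * (- 2 * of_real pi * (of_nat l)\<^sup>2 * of_real t) ^ a / fact a) = Q"
      unfolding Q_def \<delta>_def by (simp only:)
    have r: "1 / 2 * of_real ((2 * (real l)\<^sup>2 * t) powr (- 1 / 2)) * epow z d =
        epow z d * (1 / of_real (2 * sqrt (2 * ((real l)\<^sup>2 * t))))"
      unfolding powr_minus_half_eq[OF t(1) l] by simp
    have j: "jacobi_partial_theta d l z (\<i> * of_real t) =
        epow z d * (\<Sum>n. exp (- 2 * of_real pi * of_real ((real l)\<^sup>2 * t) * (of_nat n + of_real \<delta>) ^ 2))"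
      unfolding jacobi_partial_theta_eq[OF l] assms(2) power_one mult_1_left \<delta>_def[symmetric]
      by (rule suminf_mult[OF C(1)[OF T t(2)]])
    have "norm (epow z d) * norm ((\<Sum>n. exp (- 2 * of_real pi * of_real ((real l)\<^sup>2 * t) * (of_nat n + of_real \<delta>) ^ 2))
            - (1 / of_real (2 * sqrt (2 * ((real l)\<^sup>2 * t))) - Q)) \<le> norm (epow z d) * (C * ((real l)\<^sup>2 * t) ^ (N + 1))"
      unfolding Q_def by (intro mult_left_mono C(2) T t) simp
    then show "norm (jacobi_partial_theta d l z (\<i> * of_real t)
          - (1 / 2 * of_real ((2 * (real l)\<^sup>2 * t) powr (- 1 / 2)) * epow z d
             - epow z d * (\<Sum>a=0..N. of_real (bernoulli_poly (2 * a + 1) (of_rat d / real l))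
                  / of_nat (2 * a + 1)
                  * (- 2 * of_real pi * (of_nat l)\<^sup>2 * of_real t) ^ a / fact a)))
        \<le> norm (epow z d) * C * ((real l)\<^sup>2 * t) ^ (N + 1)"
      unfolding Q r j right_diff_distrib[symmetric] norm_mult mult.assoc[of "norm (epow z d)"] .
  qed
qed

text \<open>This serves case (ii) and also the lower half-plane part of case (i), where the index
  set turns out to be empty.\<close>

lemma jacobi_partial_theta_asymptotics_lower:
  fixes d :: rat and j :: int and x0 y0 :: real
  assumes l: "l \<ge> 1" and z: "z = (z0 + of_int j) / of_nat l"
    and z0: "z0 = of_real x0 + \<i> * of_real y0" and y0: "y0 < 0"
  shows "(\<lambda>t::real. jacobi_partial_theta d l z (\<i> * of_real t)
          - (of_real ((2 * (real l)\<^sup>2 * t) powr (- 1 / 2))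
               * exp (2 * of_real pi * \<i> * of_int j * of_rat d / of_nat l
                      - of_real pi * z0\<^sup>2 / (2 * (of_nat l)\<^sup>2 * of_real t))
               * (\<Sum>n\<in>{n::int. \<bar>of_int n + x0\<bar> \<le> \<bar>y0\<bar>}.
                    exp (- of_real pi * (of_int n)\<^sup>2 / (2 * (of_nat l)\<^sup>2 * of_real t)
                         - of_real pi * z0 * of_int n / ((of_nat l)\<^sup>2 * of_real t)
                         - 2 * of_real pi * \<i> * of_int n * of_rat d / of_nat l))
             + (\<Sum>a=0..N. (D_z ^^ (2 * a)) (\<lambda>w. epow w d / (1 - epow w (of_nat l))) z
                  * (- 2 * of_real pi * of_real t) ^ a / fact a)))
        \<in> O[at_right 0](\<lambda>t. of_real t ^ (N + 1))"
proof -
  define \<delta> where "\<delta> = of_rat d / real l"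
  define \<omega> where "\<omega> = exp (2 * of_real pi * \<i> * z0)"
  define E where "E = (\<lambda>T (n::int). exp (- of_real pi * (of_int n)\<^sup>2 / (2 * of_real T)
           - of_real pi * z0 * of_int n / of_real T - 2 * of_real pi * \<i> * of_int n * of_real \<delta>))"
  define \<rho> where "\<rho> = (\<lambda>T. of_real (1 / sqrt (2 * T)) * exp (- of_real pi * z0\<^sup>2 / (2 * of_real T)))"
  define \<epsilon> where "\<epsilon> = exp (2 * of_real pi * \<i> * z0 * of_real \<delta>)"
  define \<mu> where "\<mu> = exp (2 * of_real pi * \<i> * of_int j * of_rat d / of_nat l)"
  define I where "I = {n::int. \<bar>of_int n + x0\<bar> \<le> \<bar>y0\<bar>}"
  have \<delta>: "of_real \<delta> = (of_rat d / of_nat l :: complex)"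
    by (simp add: \<delta>_def of_real_of_rat)
  have \<omega>: "epow z (of_nat l) = \<omega>"
  proof -
    have "epow z (of_nat l) = exp (2 * of_real pi * \<i> * z0 + of_int j * (of_real (2 * pi) * \<i>))"
    proof -
      have "of_nat l * z = z0 + of_int j"
        using l by (simp add: z)
      then have "2 * of_real pi * \<i> * of_rat (of_nat l) * z = 2 * of_real pi * \<i> * (z0 + of_int j)"
        by (simp add: mult.assoc)
      then show ?thesis
        unfolding epow_def by (intro arg_cong[of _ _ exp]) (simp add: algebra_simps)
    qed
    also have "\<dots> = \<omega>"
      unfolding \<omega>_def exp_eq by (rule exI[of _ j]) simp
    finally show ?thesis .
  qed
  have "norm (epow z (of_nat l)) > 1"
    unfolding norm_epow_of_nat using l y0 by (simp add: z z0 mult_pos_neg)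
  then have \<omega>1: "epow z (of_nat l) \<noteq> 1" by auto
  \<comment> \<open>Since \<open>d z = \<delta> z0 + j d / l\<close>, the integer part
    \<open>j\<close> of \<open>l z\<close> contributes only the constant phase \<open>\<mu>\<close>,
    common to all terms.\<close>
  have \<epsilon>: "epow z d = \<mu> * \<epsilon>"
    unfolding epow_def \<mu>_def \<epsilon>_def \<delta> exp_add[symmetric]
    by (rule arg_cong[of _ _ exp]) (use l in \<open>simp add: z field_simps\<close>)
  obtain C where C: "\<And>T. 0 < T \<Longrightarrow> T \<le> 1 \<Longrightarrow>
      summable (\<lambda>n. \<omega> ^ n * exp (- 2 * of_real pi * of_real T * (of_nat n + of_real \<delta>) ^ 2))"
    "\<And>T. 0 < T \<Longrightarrow> T \<le> 1 \<Longrightarrow>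
      norm (\<epsilon> * (\<Sum>n. \<omega> ^ n * exp (- 2 * of_real pi * of_real T * (of_nat n + of_real \<delta>) ^ 2))
            - (\<rho> T * (\<Sum>n\<in>I. E T n) +
               \<epsilon> * (\<Sum>a=0..N. (deriv ^^ (2 * a)) (\<lambda>u. exp (of_real \<delta> * u) / (1 - \<omega> * exp u)) 0
                 * (- 2 * of_real pi * of_real T) ^ a / fact a)))
        \<le> C * T ^ (N + 1)"
    unfolding \<omega>_def \<epsilon>_def \<rho>_def E_def I_def
    by (rule twisted_gauss_sum_lower_half_plane[OF z0 y0, where N = N and \<delta> = \<delta>]) blast
  show ?thesis
    unfolding I_def[symmetric]
  proof (rule bigo_at_right_0_scaledI[of "(real l)\<^sup>2" _ "norm \<mu> * C"])
    show "(real l)\<^sup>2 > 0" using l by simp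
    fix t :: real assume t: "0 < t" "(real l)\<^sup>2 * t \<le> 1"
    define T where "T = (real l)\<^sup>2 * t"
    have T: "0 < T" "T \<le> 1" using l t by (simp_all add: T_def)
    have cT: "(of_nat l)\<^sup>2 * of_real t = (of_real T :: complex)" "2 * (of_nat l)\<^sup>2 * of_real t = (2 * of_real T :: complex)"
      by (simp_all add: T_def)
    define S where "S = (\<Sum>n. \<omega> ^ n * exp (- 2 * of_real pi * of_real T * (of_nat n + of_real \<delta>) ^ 2))"
    define Q where "Q = (\<Sum>a=0..N. (deriv ^^ (2 * a)) (\<lambda>u. exp (of_real \<delta> * u) / (1 - \<omega> * exp u)) 0
                 * (- 2 * of_real pi * of_real T) ^ a / fact a)"
    have J: "jacobi_partial_theta d l z (\<i> * of_real t) = \<mu> * (\<epsilon> * S)"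
    proof -
      have "jacobi_partial_theta d l z (\<i> * of_real t) = epow z d * S"
        unfolding jacobi_partial_theta_eq[OF l] \<omega> \<delta>_def[symmetric] T_def[symmetric] S_def
        by (rule suminf_mult[OF C(1)[OF T]])
      then show ?thesis by (simp only: \<epsilon> mult.assoc)
    qed
    have D: "(\<Sum>a=0..N. (D_z ^^ (2 * a)) (\<lambda>w. epow w d / (1 - epow w (of_nat l))) z
               * (- 2 * of_real pi * of_real t) ^ a / fact a) = \<mu> * (\<epsilon> * Q)"
      unfolding D_z_geometric_sum[OF l \<omega>1] \<omega> \<delta>_def[symmetric] T_def[symmetric] Q_def[symmetric] \<epsilon> mult.assoc[of \<mu> \<epsilon>]
      by (rule refl)
    have R: "of_real ((2 * (real l)\<^sup>2 * t) powr (- 1 / 2))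
               * exp (2 * of_real pi * \<i> * of_int j * of_rat d / of_nat l
                      - of_real pi * z0\<^sup>2 / (2 * (of_nat l)\<^sup>2 * of_real t))
               * (\<Sum>n\<in>I. exp (- of_real pi * (of_int n)\<^sup>2 / (2 * (of_nat l)\<^sup>2 * of_real t)
                         - of_real pi * z0 * of_int n / ((of_nat l)\<^sup>2 * of_real t)
                         - 2 * of_real pi * \<i> * of_int n * of_rat d / of_nat l)) = \<mu> * (\<rho> T * (\<Sum>n\<in>I. E T n))"
    proof -
      have "exp (2 * of_real pi * \<i> * of_int j * of_rat d / of_nat l - of_real pi * z0\<^sup>2 / (2 * of_real T)) =
          \<mu> * exp (- of_real pi * z0\<^sup>2 / (2 * of_real T))"
        unfolding \<mu>_def exp_add[symmetric] by simp
      moreover have "(\<Sum>n\<in>I. exp (- of_real pi * (of_int n)\<^sup>2 / (2 * of_real T)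
                         - of_real pi * z0 * of_int n / of_real T
                         - 2 * of_real pi * \<i> * of_int n * of_rat d / of_nat l)) = (\<Sum>n\<in>I. E T n)"
        unfolding E_def \<delta> times_divide_eq_right ..
      ultimately show ?thesis
        unfolding cT powr_minus_half_eq[OF t(1) l] T_def[symmetric] \<rho>_def by (simp only: mult_ac)
    qed
    have "norm (\<mu> * (\<epsilon> * S - (\<rho> T * (\<Sum>n\<in>I. E T n) + \<epsilon> * Q))) \<le> norm \<mu> * (C * T ^ (N + 1))"
      unfolding S_def Q_def norm_mult by (intro mult_left_mono C(2) T) simp
    then show "norm (jacobi_partial_theta d l z (\<i> * of_real t)
          - (of_real ((2 * (real l)\<^sup>2 * t) powr (- 1 / 2))
               * exp (2 * of_real pi * \<i> * of_int j * of_rat d / of_nat l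
                      - of_real pi * z0\<^sup>2 / (2 * (of_nat l)\<^sup>2 * of_real t))
               * (\<Sum>n\<in>I. exp (- of_real pi * (of_int n)\<^sup>2 / (2 * (of_nat l)\<^sup>2 * of_real t)
                         - of_real pi * z0 * of_int n / ((of_nat l)\<^sup>2 * of_real t)
                         - 2 * of_real pi * \<i> * of_int n * of_rat d / of_nat l))
             + (\<Sum>a=0..N. (D_z ^^ (2 * a)) (\<lambda>w. epow w d / (1 - epow w (of_nat l))) z
                  * (- 2 * of_real pi * of_real t) ^ a / fact a))) \<le> norm \<mu> * C * ((real l)\<^sup>2 * t) ^ (N + 1)"
      unfolding J D R T_def[symmetric] distrib_left[symmetric] right_diff_distrib[symmetric] mult.assoc[of "norm \<mu>"] .
  qed
qed

theorem theorem1p1: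
  fixes d :: rat and l :: nat and z z0 :: complex and x0 y0 :: real and j :: int and N :: nat
  assumes "l \<ge> 1"
    and "z = (z0 + of_int j) / of_nat l"
    and "z0 = of_real x0 + \<i> * of_real y0"
    and "- 1 / 2 < x0" and "x0 \<le> 1 / 2"
  shows
    "(Im z > 0 \<or> (Im z < 0 \<and> \<bar>x0\<bar> > \<bar>y0\<bar>) \<or>
        z \<in> \<real> - range (\<lambda>k::int. of_int k / of_nat l) \<longrightarrow>
      (\<lambda>t::real. jacobi_partial_theta d l z (\<i> * of_real t)
          - (\<Sum>a=0..N. (D_z ^^ (2 * a)) (\<lambda>w. epow w d / (1 - epow w (of_nat l))) z
               * (- 2 * of_real pi * of_real t) ^ a / fact a))
        \<in> O[at_right 0](\<lambda>t. of_real t ^ (N + 1)))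
   \<and> (Im z < 0 \<and> \<bar>x0\<bar> \<le> \<bar>y0\<bar> \<longrightarrow>
      (\<lambda>t::real. jacobi_partial_theta d l z (\<i> * of_real t)
          - (of_real ((2 * (real l)\<^sup>2 * t) powr (- 1 / 2))
               * exp (2 * of_real pi * \<i> * of_int j * of_rat d / of_nat l
                      - of_real pi * z0\<^sup>2 / (2 * (of_nat l)\<^sup>2 * of_real t))
               * (\<Sum>n\<in>{n::int. \<bar>of_int n + x0\<bar> \<le> \<bar>y0\<bar>}.
                    exp (- of_real pi * (of_int n)\<^sup>2 / (2 * (of_nat l)\<^sup>2 * of_real t)
                         - of_real pi * z0 * of_int n / ((of_nat l)\<^sup>2 * of_real t)
                         - 2 * of_real pi * \<i> * of_int n * of_rat d / of_nat l))
             + (\<Sum>a=0..N. (D_z ^^ (2 * a)) (\<lambda>w. epow w d / (1 - epow w (of_nat l))) z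
                  * (- 2 * of_real pi * of_real t) ^ a / fact a)))
        \<in> O[at_right 0](\<lambda>t. of_real t ^ (N + 1)))
   \<and> (z \<in> range (\<lambda>k::int. of_int k / of_nat l) \<longrightarrow>
      (\<lambda>t::real. jacobi_partial_theta d l z (\<i> * of_real t)
          - (1 / 2 * of_real ((2 * (real l)\<^sup>2 * t) powr (- 1 / 2)) * epow z d
             - epow z d * (\<Sum>a=0..N. of_real (bernoulli_poly (2 * a + 1) (of_rat d / real l))
                  / of_nat (2 * a + 1)
                  * (- 2 * of_real pi * (of_nat l)\<^sup>2 * of_real t) ^ a / fact a)))
        \<in> O[at_right 0](\<lambda>t. of_real t ^ (N + 1)))"
proof (intro conjI impI)
  have Im: "Im z = y0 / real l"
    using assms(1) by (simp add: assms(2,3))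
  have y0: "y0 < 0" if "Im z < 0"
    using that assms(1) unfolding Im by (simp add: divide_less_0_iff)
  let ?D = "\<lambda>t::real. \<Sum>a=0..N. (D_z ^^ (2 * a)) (\<lambda>w. epow w d / (1 - epow w (of_nat l))) z
               * (- 2 * of_real pi * of_real t) ^ a / fact a"
  assume case_i: "Im z > 0 \<or> (Im z < 0 \<and> \<bar>x0\<bar> > \<bar>y0\<bar>) \<or> z \<in> \<real> - range (\<lambda>k::int. of_int k / of_nat l)"
  show "(\<lambda>t::real. jacobi_partial_theta d l z (\<i> * of_real t) - ?D t) \<in> O[at_right 0](\<lambda>t. of_real t ^ (N + 1))"
  proof (cases "Im z < 0")
    case True
    then have "\<bar>x0\<bar> > \<bar>y0\<bar>"
      using case_i by (auto simp: complex_is_Real_iff)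
    \<comment> \<open>For \<open>n \<noteq> 0\<close> the range of \<open>x0\<close> gives
      \<open>|n + x0| \<ge> 1 - |x0| \<ge> 1/2 \<ge> |x0|\<close>, so the condition at
      \<open>n = 0\<close> decides all indices.\<close>
    have "\<bar>of_int n + x0\<bar> > \<bar>y0\<bar>" for n :: int
    proof (cases "n = 0")
      case False
      then have "\<bar>real_of_int n\<bar> \<ge> 1" by linarith
      then show ?thesis using assms(4,5) \<open>\<bar>x0\<bar> > \<bar>y0\<bar>\<close> by linarith
    qed (use \<open>\<bar>x0\<bar> > \<bar>y0\<bar>\<close> in simp)
    then have empty: "{n::int. \<bar>of_int n + x0\<bar> \<le> \<bar>y0\<bar>} = {}"
      by (auto simp: not_le)
    show ?thesis
      using jacobi_partial_theta_asymptotics_lower[OF assms(1-3) y0[OF True], of d N]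
      unfolding empty sum.empty mult_zero_right add_0_left .
  next
    case False
    \<comment> \<open>Either \<open>z\<close> is off the real axis, which contains the lattice, or
      the lattice is excluded by assumption.\<close>
    have "z \<notin> range (\<lambda>k::int. of_int k / of_nat l)"
      using case_i False by auto
    then show ?thesis
      using False assms(1)
      by (intro jacobi_partial_theta_asymptotics_closed_upper) (auto simp: epow_eq_1_iff)
  qed
next
  assume "Im z < 0 \<and> \<bar>x0\<bar> \<le> \<bar>y0\<bar>"
  then have "y0 < 0"
    using assms(1) by (simp add: assms(2,3) divide_less_0_iff)
  with assms(1-3) show "(\<lambda>t::real. jacobi_partial_theta d l z (\<i> * of_real t)
          - (of_real ((2 * (real l)\<^sup>2 * t) powr (- 1 / 2))
               * exp (2 * of_real pi * \<i> * of_int j * of_rat d / of_nat l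
                      - of_real pi * z0\<^sup>2 / (2 * (of_nat l)\<^sup>2 * of_real t))
               * (\<Sum>n\<in>{n::int. \<bar>of_int n + x0\<bar> \<le> \<bar>y0\<bar>}.
                    exp (- of_real pi * (of_int n)\<^sup>2 / (2 * (of_nat l)\<^sup>2 * of_real t)
                         - of_real pi * z0 * of_int n / ((of_nat l)\<^sup>2 * of_real t)
                         - 2 * of_real pi * \<i> * of_int n * of_rat d / of_nat l))
             + (\<Sum>a=0..N. (D_z ^^ (2 * a)) (\<lambda>w. epow w d / (1 - epow w (of_nat l))) z
                  * (- 2 * of_real pi * of_real t) ^ a / fact a)))
        \<in> O[at_right 0](\<lambda>t. of_real t ^ (N + 1))"
    by (rule jacobi_partial_theta_asymptotics_lower)
next
  assume "z \<in> range (\<lambda>k::int. of_int k / of_nat l)"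
  with assms(1) have "epow z (of_nat l) = 1"
    by (simp add: epow_eq_1_iff)
  with assms(1) show "(\<lambda>t::real. jacobi_partial_theta d l z (\<i> * of_real t)
          - (1 / 2 * of_real ((2 * (real l)\<^sup>2 * t) powr (- 1 / 2)) * epow z d
             - epow z d * (\<Sum>a=0..N. of_real (bernoulli_poly (2 * a + 1) (of_rat d / real l))
                  / of_nat (2 * a + 1)
                  * (- 2 * of_real pi * (of_nat l)\<^sup>2 * of_real t) ^ a / fact a)))
        \<in> O[at_right 0](\<lambda>t. of_real t ^ (N + 1))"
    by (rule jacobi_partial_theta_asymptotics_lattice)
qed

end
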